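(* Let $d,k\in\mathbb{N}$, let $(n_i)_{i\ge1}$ be a sequence of $d$-admissible numbers with $\lim_{i\to\infty}n_i=\infty$, and let $X_i$ be a $(d,k,n_i)$-random Steiner complex. For each $i$ fix a $(d-1)$-face $\sigma_i$ of $X_i$ (i.e. a $d$-element subset of $[n_i]$). Then for every $r>0$, \[ \lim_{i\to\infty}\mathbb{P}\big(X_i(\sigma_i,r)\cong T_{d,k}(r)\big)=1, \] where $\cong$ denotes simplicial isomorphism.
   Context: $d$-admissible: $n\ge d+1$ with $d-j\mid\binom{n-j-1}{d-j-1}$ for all $0\le j\le d-1$. $(n,d)$-Steiner system: family of $(d+1)$-subsets of $[n]$ containing every $d$-subset of $[n]$ in exactly one member. $(d,k,n)$-random Steiner complex: the complex on $[n]$ consisting of all subsets of size $\le d$ together with $S_1\cup\dots\cup S_k$, $S_j$ i.i.d. uniformly random $(n,d)$-Steiner systems. For a $d$-complex $X$, the line graph $G_d(X)$ has vertex set $X^{d-1}$ (the $(d-1)$-faces) with $\sigma,\sigma'$ adjacent iff $\sigma\ne\sigma'$ and $\sigma\cup\sigma'\in X^d$; $B_r(\sigma_0,X)$ is the ball of radius $r$ around $\sigma_0$ in its graph metric. The $r$-neighbouring complex $X(\sigma_0,r)$ is the subcomplex $Y$ with $Y^{d-1}=B_r(\sigma_0,X)$, $Y^d=\{\tau\in X^d:\text{all }(d-1)\text{-faces of }\tau\text{ lie in }Y^{d-1}\}$, and, for $\ell<d-1$, $Y^\ell=\{\eta\in X^\ell:\eta\subseteq\sigma\text{ for some }\sigma\in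 Y^{d-1}\}$. The arboreal complex $T_{d,k}$ is built by starting with a single $d$-face, attaching to each of its $(d-1)$-faces $k-1$ new $d$-faces, each using a new vertex, and then inductively attaching $k-1$ new $d$-faces (each with a new vertex) to each $(d-1)$-face created in the previous step; every $(d-1)$-face of $T_{d,k}$ has degree $k$. Since $T_{d,k}$ is transitive on $(d-1)$-faces, $T_{d,k}(r)$ denotes $T_{d,k}(\sigma,r)$ for any $(d-1)$-face $\sigma$ (well-defined up to isomorphism). A simplicial isomorphism is a bijection of vertex sets inducing a bijection of faces. *)

theory Defs
  imports "HOL-Probability.Probability" "HOL-Library.FSet" "HOL-Library.Extended_Nat"
begin

section \<open>Simplicial complexes\<close>

text \<open>A complex is a downward closed family of finite sets, the empty face included. Dimensions
  are integers, so that the empty face has dimension \<open>-1\<close>.\<close>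

definition faces :: "'a set set \<Rightarrow> int \<Rightarrow> 'a set set" where
  "faces X l = {\<sigma> \<in> X. finite \<sigma> \<and> int (card \<sigma>) = l + 1}"

definition simplicial_iso :: "'a set set \<Rightarrow> 'b set set \<Rightarrow> bool" where
  "simplicial_iso X Y \<longleftrightarrow>
     (\<exists>f. bij_betw f (\<Union>X) (\<Union>Y) \<and> bij_betw (\<lambda>\<sigma>. f ` \<sigma>) X Y)"

section \<open>Line graph and neighbouring complexes\<close>

definition line_graph :: "nat \<Rightarrow> 'a set set \<Rightarrow> ('a set \<times> 'a set) set" where
  "line_graph d X =
     {(\<sigma>, \<sigma>'). \<sigma> \<in> faces X (int d - 1) \<and> \<sigma>' \<in> faces X (int d - 1) \<and>
        \<sigma> \<noteq> \<sigma>' \<and> \<sigma> \<union> \<sigma>' \<in> faces X (int d)}"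

text \<open>The least length of a walk; it is \<open>\<infinity>\<close> (the infimum of the empty set) if there is none.\<close>

definition line_dist :: "nat \<Rightarrow> 'a set set \<Rightarrow> 'a set \<Rightarrow> 'a set \<Rightarrow> enat" where
  "line_dist d X \<sigma> \<sigma>' = Inf {enat m | m. (\<sigma>, \<sigma>') \<in> line_graph d X ^^ m}"

definition line_ball :: "nat \<Rightarrow> 'a set set \<Rightarrow> 'a set \<Rightarrow> real \<Rightarrow> 'a set set" where
  "line_ball d X \<sigma>0 r =
     {\<sigma> \<in> faces X (int d - 1). ereal_of_enat (line_dist d X \<sigma>0 \<sigma>) \<le> ereal r}"

definition nbhd_complex :: "nat \<Rightarrow> 'a set set \<Rightarrow> 'a set \<Rightarrow> real \<Rightarrow> 'a set set" where
  "nbhd_complex d X \<sigma>0 r =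
     line_ball d X \<sigma>0 r
     \<union> {\<tau> \<in> faces X (int d). \<forall>\<sigma>. \<sigma> \<subseteq> \<tau> \<and> card \<sigma> = d \<longrightarrow> \<sigma> \<in> line_ball d X \<sigma>0 r}
     \<union> {\<eta>. \<exists>l < int d - 1. \<eta> \<in> faces X l \<and> (\<exists>\<sigma> \<in> line_ball d X \<sigma>0 r. \<eta> \<subseteq> \<sigma>)}"

section \<open>Random Steiner complexes\<close>

definition admissible :: "nat \<Rightarrow> nat \<Rightarrow> bool" where
  "admissible d n \<longleftrightarrow>
     n \<ge> d + 1 \<and> (\<forall>j<d. (d - j) dvd ((n - j - 1) choose (d - j - 1)))"

definition steiner_systems :: "nat \<Rightarrow> nat \<Rightarrow> nat set set set" where
  "steiner_systems n d =
     {S. (\<forall>A\<in>S. A \<subseteq> {1..n} \<and> card A = d + 1) \<and>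
         (\<forall>B. B \<subseteq> {1..n} \<and> card B = d \<longrightarrow> (\<exists>!A. A \<in> S \<and> B \<subseteq> A))}"

text \<open>\<open>X\<close> is a complex-valued random variable on the probability space \<open>M\<close>. As
  \<open>M\<close> is a probability space, for \<open>k \<ge> 1\<close> this can only hold if some Steiner system
  exists (divisibility conditions alone do not ensure that).\<close>

definition random_steiner_complex ::
    "nat \<Rightarrow> nat \<Rightarrow> nat \<Rightarrow> 'w measure \<Rightarrow> ('w \<Rightarrow> nat set set) \<Rightarrow> bool" where
  "random_steiner_complex d k n M X \<longleftrightarrow>
     prob_space M \<and>
     (\<exists>S :: nat \<Rightarrow> 'w \<Rightarrow> nat set set.
        prob_space.indep_vars M (\<lambda>_. count_space (steiner_systems n d)) S {1..k} \<and>
        (\<forall>j\<in>{1..k}. distr M (count_space (steiner_systems n d)) (S j)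
                      = uniform_count_measure (steiner_systems n d)) \<and>
        (\<forall>\<omega>\<in>space M. X \<omega> = {A. A \<subseteq> {1..n} \<and> card A \<le> d} \<union> (\<Union>j\<in>{1..k}. S j \<omega>)))"

section \<open>The arboreal complex\<close>

text \<open>\<open>Base\<close> vertices span the initial \<open>d\<close>-face; \<open>Apex \<sigma> j\<close> is the new vertex of the
  \<open>j\<close>-th \<open>d\<close>-face attached to \<open>\<sigma>\<close>. Each \<open>(d-1)\<close>-face is used for attachment only once and
  the constructor is injective, so these vertices are indeed new and pairwise distinct.\<close>

datatype tree_vertex = Base nat | Apex "tree_vertex fset" nat

definition attach :: "nat \<Rightarrow> tree_vertex set \<Rightarrow> tree_vertex set set" where
  "attach k \<sigma> = (\<Union>j<k - 1. Pow (insert (Apex (Abs_fset \<sigma>) j) \<sigma>))"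

text \<open>The complex after \<open>m\<close> steps, together with the \<open>(d-1)\<close>-faces created in step \<open>m\<close>.\<close>

primrec arboreal_stage ::
    "nat \<Rightarrow> nat \<Rightarrow> nat \<Rightarrow> tree_vertex set set \<times> tree_vertex set set" where
  "arboreal_stage d k 0 =
     (Pow (Base ` {0..d}), faces (Pow (Base ` {0..d})) (int d - 1))"
| "arboreal_stage d k (Suc m) =
     (let (Y, F) = arboreal_stage d k m; Y' = Y \<union> (\<Union>\<sigma>\<in>F. attach k \<sigma>)
      in (Y', faces Y' (int d - 1) - faces Y (int d - 1)))"

definition arboreal :: "nat \<Rightarrow> nat \<Rightarrow> tree_vertex set set" where
  "arboreal d k = (\<Union>m. fst (arboreal_stage d k m))"

end

theory Submission
  imports Defs
begin

text \<open>A Steiner complex carries a colouring of its \<open>d\<close>-faces by the \<open>k\<close> systems, in which every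
  \<open>(d-1)\<close>-face lies in exactly one \<open>d\<close>-face of each colour; so does the arboreal complex. Hence
  there is a colour-preserving cover \<open>\<phi>\<close> of the Steiner complex by the arboreal complex that takes a
  fixed \<open>(d-1)\<close>-face to \<open>\<sigma>\<close>. It maps line balls onto line balls, and it restricts to an
  isomorphism of neighbouring complexes as soon as it is injective on a finite set \<open>D\<close> of vertices
  that depends only on \<open>d, k, r\<close>. If \<open>\<phi>\<close> takes the same value at two vertices and is injective
  before, then for some tree vertex \<open>q\<close> the value \<open>\<phi> q\<close> is determined by the values at older
  vertices and by the systems of colours other than that of \<open>q\<close>. Transposing \<open>\<phi> q\<close> with an unused
  point in the system of the colour of \<open>q\<close> only preserves the uniform distribution, so this has
  probability at most \<open>1 / (n - card D)\<close>.\<close>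

text \<open>Of uniform Steiner systems the proof uses only the invariance under permutations of the
  points, neither their number nor the law of a system conditioned on some of its blocks; so the
  cover is not exposed step by step. The obvious move, to switch \<open>\<phi> t\<close> away when
  it collides with an older \<open>\<phi> s\<close>, fails: the two values are one point, and
  transposing it could disturb the blocks that produced \<open>\<phi> s\<close>. Hence the switch is
  made at a vertex \<open>q\<close> whose value is still fresh, and the collision is read as an
  equation for \<open>\<phi> q\<close>. That requires a block through \<open>\<phi> q\<close> of a
  colour other than that of \<open>q\<close>, because only the other systems survive the switch.
  Such a block comes from the rule that kids of a \<open>(d-1)\<close>-face avoid the colour of its
  newest vertex, or from \<open>s\<close> and \<open>t\<close> having different colours. A union
  bound over collisions costs the factor \<open>(card D)\<^sup>2\<close>.\<close>

lemma line_ball_iff: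
  "\<sigma> \<in> line_ball d X \<sigma>0 r \<longleftrightarrow> \<sigma> \<in> faces X (int d - 1) \<and>
     (\<exists>m. real m \<le> r \<and> (\<sigma>0, \<sigma>) \<in> line_graph d X ^^ m)"
proof -
  let ?W = "{enat m | m. (\<sigma>0, \<sigma>) \<in> line_graph d X ^^ m}"
  have "ereal_of_enat (Inf ?W) \<le> ereal r \<longleftrightarrow>
        (\<exists>m. real m \<le> r \<and> (\<sigma>0, \<sigma>) \<in> line_graph d X ^^ m)"
  proof
    assume *: "ereal_of_enat (Inf ?W) \<le> ereal r"
    \<comment> \<open>Without walks the infimum is \<infinity>, which exceeds every real
      \<open>r\<close>; otherwise it is attained, \<open>enat\<close> being well ordered.\<close>
    then have "?W \<noteq> {}" by (intro notI) (simp add: Inf_enat_def)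
    then obtain x where "x \<in> ?W" by blast
    then have "Inf ?W \<in> ?W" by (rule wellorder_InfI)
    with * show "\<exists>m. real m \<le> r \<and> (\<sigma>0, \<sigma>) \<in> line_graph d X ^^ m" by auto
  next
    assume "\<exists>m. real m \<le> r \<and> (\<sigma>0, \<sigma>) \<in> line_graph d X ^^ m"
    then obtain m where m: "real m \<le> r" "(\<sigma>0, \<sigma>) \<in> line_graph d X ^^ m" by blast
    then have "Inf ?W \<le> enat m" by (intro Inf_lower) blast
    then have "ereal_of_enat (Inf ?W) \<le> ereal_of_enat (enat m)"
      by (simp only: ereal_of_enat_le_iff)
    with m show "ereal_of_enat (Inf ?W) \<le> ereal r" by (simp add: order_trans)
  qed
  then show ?thesis by (simp add: line_ball_def line_dist_def)
qed

section \<open>Coloured complexes and covers\<close>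

text \<open>The colour classes need not be disjoint, since two Steiner systems may share blocks.\<close>

locale coloured_complex =
  fixes d k :: nat and X :: "'a set set" and C :: "nat \<Rightarrow> 'a set set"
  assumes d_pos: "d \<ge> 1" and k_pos: "k \<ge> 1"
    and down_closed: "A \<in> X \<Longrightarrow> B \<subseteq> A \<Longrightarrow> B \<in> X"
    and finite_face: "A \<in> X \<Longrightarrow> finite A"
    and top_faces: "faces X (int d) = (\<Union>c\<in>{1..k}. C c)"
    and ex1_face: "c \<in> {1..k} \<Longrightarrow> B \<in> faces X (int d - 1) \<Longrightarrow> \<exists>!A. A \<in> C c \<and> B \<subseteq> A"

text \<open>Meaningful when \<open>B\<close> is a \<open>(d-1)\<close>-face, called a ridge below,
  and \<open>S\<close> a colour class; elsewhere \<open>THE\<close> is unspecified.\<close>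

definition apex :: "'a set set \<Rightarrow> 'a set \<Rightarrow> 'a" where
  "apex S B = (THE v. v \<notin> B \<and> insert v B \<in> S)"

context coloured_complex
begin

lemma ridge_iff: "B \<in> faces X (int d - 1) \<longleftrightarrow> B \<in> X \<and> card B = d"
  using finite_face by (auto simp: faces_def)

lemma coloured_faceD:
  assumes "c \<in> {1..k}" "A \<in> C c"
  shows "A \<in> X" "finite A" "card A = Suc d" "A \<in> faces X (int d)"
proof -
  show A: "A \<in> faces X (int d)" using assms top_faces by blast
  then show "A \<in> X" "finite A" "card A = Suc d" by (auto simp: faces_def)
qed

lemma ridge_of_face:
  assumes "c \<in> {1..k}" "A \<in> C c" "B \<subseteq> A" "card B = d"
  shows "B \<in> faces X (int d - 1)"
  using coloured_faceD[OF assms(1,2)] assms(3,4) down_closed ridge_iff by blast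

lemma apex_unique:
  assumes c: "c \<in> {1..k}" and B: "B \<in> faces X (int d - 1)"
  shows "apex (C c) B \<notin> B \<and> insert (apex (C c) B) B \<in> C c"
    and "v \<notin> B \<Longrightarrow> insert v B \<in> C c \<Longrightarrow> v = apex (C c) B"
proof -
  obtain A where A: "A \<in> C c" "B \<subseteq> A" using ex1_face[OF c B] by blast
  have cB: "finite B" "card B = d" using B by (auto simp: faces_def)
  have "card (A - B) = 1" using coloured_faceD[OF c A(1)] A(2) cB by (simp add: card_Diff_subset)
  then obtain v where v: "A - B = {v}" by (auto simp: card_1_singleton_iff)
  then have vA: "insert v B = A" "v \<notin> B" using A(2) by auto
  have uniq: "w = v" if "w \<notin> B" "insert w B \<in> C c" for w
  proof -
    have "insert w B = A" using ex1_face[OF c B] A that(2) by blast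
    then show ?thesis using that(1) v by auto
  qed
  have vC: "v \<notin> B \<and> insert v B \<in> C c" using vA A(1) by simp
  have "apex (C c) B = v" unfolding apex_def by (rule the_equality, rule vC) (use uniq in blast)
  then show "apex (C c) B \<notin> B \<and> insert (apex (C c) B) B \<in> C c"
    and "v \<notin> B \<Longrightarrow> insert v B \<in> C c \<Longrightarrow> v = apex (C c) B" for v
    using vC uniq by simp_all
qed

lemma line_graph_face:
  assumes "(\<rho>, \<rho>') \<in> line_graph d X"
  obtains c A where "c \<in> {1..k}" "A \<in> C c" "\<rho> \<subseteq> A" "\<rho>' \<subseteq> A" "card \<rho>' = d" "\<rho> \<noteq> \<rho>'" "\<rho> \<union> \<rho>' = A"
    "\<rho> \<in> faces X (int d - 1)" "\<rho>' \<in> faces X (int d - 1)"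
proof -
  have *: "\<rho> \<in> faces X (int d - 1)" "\<rho>' \<in> faces X (int d - 1)" "\<rho> \<noteq> \<rho>'"
    "\<rho> \<union> \<rho>' \<in> (\<Union>c\<in>{1..k}. C c)"
    using assms top_faces by (auto simp: line_graph_def)
  then obtain c where "c \<in> {1..k}" "\<rho> \<union> \<rho>' \<in> C c" by blast
  moreover have "card \<rho>' = d" using *(2) ridge_iff by simp
  ultimately show ?thesis
    using that[of c "\<rho> \<union> \<rho>'"] *(1-3) by (simp add: sup_ge1 sup_ge2)
qed

lemma line_graphI:
  assumes "c \<in> {1..k}" "A \<in> C c" "\<rho> \<subseteq> A" "\<rho>' \<subseteq> A" "card \<rho> = d" "card \<rho>' = d" "\<rho> \<noteq> \<rho>'"
  shows "(\<rho>, \<rho>') \<in> line_graph d X" "\<rho> \<union> \<rho>' = A"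
proof -
  note A = coloured_faceD[OF assms(1,2)]
  have fin: "finite \<rho>" "finite \<rho>'" using assms(3,4) A(2) finite_subset by blast+
  have "\<rho> \<subset> \<rho> \<union> \<rho>'"
    using assms(5-7) fin by (metis card_subset_eq psubsetI sup_ge1 sup_ge2)
  then have "d < card (\<rho> \<union> \<rho>')" using fin assms(5) by (metis finite_UnI psubset_card_mono)
  then show U: "\<rho> \<union> \<rho>' = A" using A assms(3,4) by (intro card_seteq) auto
  show "(\<rho>, \<rho>') \<in> line_graph d X"
    using U A(4) assms ridge_of_face unfolding line_graph_def by blast
qed

lemma walk_ridge:
  assumes "\<rho> \<in> faces X (int d - 1)" "(\<rho>, \<rho>') \<in> line_graph d X ^^ m"
  shows "\<rho>' \<in> faces X (int d - 1)"
  using assms(2,1) by (cases m) (auto simp: line_graph_def)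

text \<open>Local finiteness: a ridge has one face of each of the \<open>k\<close> colours above it,
  and its neighbours are subsets of these.\<close>

lemma finite_walk:
  assumes "\<rho> \<in> faces X (int d - 1)"
  shows "finite {\<rho>'. (\<rho>, \<rho>') \<in> line_graph d X ^^ m}"
proof (induction m)
  case 0
  then show ?case by simp
next
  case (Suc m)
  let ?W = "{\<rho>'. (\<rho>, \<rho>') \<in> line_graph d X ^^ m}"
  have "{\<rho>'. (\<rho>, \<rho>') \<in> line_graph d X ^^ Suc m}
      \<subseteq> (\<Union>\<rho>'\<in>?W. \<Union>c\<in>{1..k}. Pow (insert (apex (C c) \<rho>') \<rho>'))"
  proof
    fix \<pi> assume "\<pi> \<in> {\<rho>'. (\<rho>, \<rho>') \<in> line_graph d X ^^ Suc m}"
    then obtain \<rho>' where \<rho>': "\<rho>' \<in> ?W" "(\<rho>', \<pi>) \<in> line_graph d X" by auto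
    obtain c A where cA: "c \<in> {1..k}" "A \<in> C c" "\<rho>' \<subseteq> A" "\<pi> \<subseteq> A" "\<rho>' \<in> faces X (int d - 1)"
      using line_graph_face[OF \<rho>'(2)] by metis
    then have "A = insert (apex (C c) \<rho>') \<rho>'"
      using ex1_face[of c \<rho>'] apex_unique(1)[of c \<rho>'] by blast
    then show "\<pi> \<in> (\<Union>\<rho>'\<in>?W. \<Union>c\<in>{1..k}. Pow (insert (apex (C c) \<rho>') \<rho>'))"
      using cA \<rho>'(1) by blast
  qed
  moreover have "finite \<rho>'" if "\<rho>' \<in> ?W" for \<rho>'
    using walk_ridge[OF assms] that finite_face by (auto simp: faces_def)
  ultimately show ?case using Suc by (elim finite_subset) auto
qed

lemma finite_line_ball:
  assumes "\<rho> \<in> faces X (int d - 1)"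
  shows "finite (line_ball d X \<rho> r)"
proof (rule finite_subset)
  show "line_ball d X \<rho> r \<subseteq> (\<Union>m\<in>{..nat \<lfloor>r\<rfloor>}. {\<rho>'. (\<rho>, \<rho>') \<in> line_graph d X ^^ m})"
  proof
    fix \<rho>' assume "\<rho>' \<in> line_ball d X \<rho> r"
    then obtain m where "real m \<le> r" "(\<rho>, \<rho>') \<in> line_graph d X ^^ m"
      unfolding line_ball_iff by blast
    moreover from this have "m \<le> nat \<lfloor>r\<rfloor>" by (simp add: le_nat_floor)
    ultimately show "\<rho>' \<in> (\<Union>m\<in>{..nat \<lfloor>r\<rfloor>}. {\<rho>'. (\<rho>, \<rho>') \<in> line_graph d X ^^ m})" by blast
  qed
qed (use finite_walk[OF assms] in auto)

text \<open>The dimension \<open>d - 1\<close> and those below it, separate in the definition,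
  together form the downward closure of the ball. In this form images under a map are easily
  computed.\<close>

lemma nbhd_complex_eq:
  "nbhd_complex d X \<rho> r = (\<Union>\<sigma>\<in>line_ball d X \<rho> r. Pow \<sigma>) \<union>
     {A \<in> faces X (int d). \<forall>\<sigma>. \<sigma> \<subseteq> A \<and> card \<sigma> = d \<longrightarrow> \<sigma> \<in> line_ball d X \<rho> r}"
proof -
  let ?B = "line_ball d X \<rho> r"
  have "?B \<union> {\<eta>. \<exists>l < int d - 1. \<eta> \<in> faces X l \<and> (\<exists>\<sigma> \<in> ?B. \<eta> \<subseteq> \<sigma>)} = (\<Union>\<sigma>\<in>?B. Pow \<sigma>)"
    (is "?L = ?R")
  proof
    show "?L \<subseteq> ?R" by auto
    show "?R \<subseteq> ?L"
    proof
      fix \<eta> assume "\<eta> \<in> ?R"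
      then obtain \<sigma> where \<sigma>: "\<sigma> \<in> ?B" "\<eta> \<subseteq> \<sigma>" by blast
      then have s: "\<sigma> \<in> X" "card \<sigma> = d" "finite \<sigma>"
        using ridge_iff finite_face by (auto simp: line_ball_iff)
      show "\<eta> \<in> ?L"
      proof (cases "\<eta> = \<sigma>")
        case False
        then have "card \<eta> < d" using s \<sigma>(2) by (metis psubsetI psubset_card_mono)
        moreover have "\<eta> \<in> faces X (int (card \<eta>) - 1)"
          using down_closed[OF s(1) \<sigma>(2)] finite_face by (auto simp: faces_def)
        ultimately show ?thesis using \<sigma> by (intro UnI2 CollectI exI[of _ "int (card \<eta>) - 1"]) auto
      qed (use \<sigma> in auto)
    qed
  qed
  then show ?thesis unfolding nbhd_complex_def by blast
qed

end

section \<open>Covers: unique lifting, images of balls, isomorphism of neighbouring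
  complexes\<close>

locale cover =
  dom: coloured_complex d k T CT + cod: coloured_complex d k X CX
  for d k and T :: "'a set set" and CT and X :: "'b set set" and CX +
  fixes \<phi> :: "'a \<Rightarrow> 'b"
  assumes cover_face: "c \<in> {1..k} \<Longrightarrow> A \<in> CT c \<Longrightarrow> inj_on \<phi> A \<and> \<phi> ` A \<in> CX c"
begin

text \<open>The locale constrains \<open>\<phi>\<close> on \<open>d\<close>-faces only; a ridge
  inherits the property from the face of colour 1 above it.\<close>

lemma cover_ridge:
  assumes "\<rho> \<in> faces T (int d - 1)"
  shows "inj_on \<phi> \<rho>" "\<phi> ` \<rho> \<in> faces X (int d - 1)"
proof -
  have 1: "1 \<in> {1..k}" using dom.k_pos by simp
  obtain A where A: "A \<in> CT 1" "\<rho> \<subseteq> A" using dom.ex1_face[OF 1 assms] by blast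
  note cA = cover_face[OF 1 A(1)]
  show i: "inj_on \<phi> \<rho>" using cA A(2) inj_on_subset by blast
  have "card (\<phi> ` \<rho>) = d" using assms dom.ridge_iff i by (simp add: card_image)
  then show "\<phi> ` \<rho> \<in> faces X (int d - 1)"
    using cod.ridge_of_face[OF 1, of "\<phi> ` A" "\<phi> ` \<rho>"] cA image_mono[OF A(2), of \<phi>] by blast
qed

text \<open>The face of colour \<open>c\<close> above \<open>\<rho>\<close> has an image of colour
  \<open>c\<close> above the image of \<open>\<rho>\<close>, and only \<open>A'\<close> is such a
  face.\<close>

lemma lift_face:
  assumes "\<rho> \<in> faces T (int d - 1)" "c \<in> {1..k}" "A' \<in> CX c" "\<phi> ` \<rho> \<subseteq> A'"
  obtains A where "A \<in> CT c" "\<rho> \<subseteq> A" "\<phi> ` A = A'" "inj_on \<phi> A"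
proof -
  obtain A where A: "A \<in> CT c" "\<rho> \<subseteq> A" using dom.ex1_face[OF assms(2,1)] by blast
  have "\<phi> ` A = A'"
    using cod.ex1_face[OF assms(2) cover_ridge(2)[OF assms(1)]] cover_face[OF assms(2) A(1)]
      assms(3,4) image_mono[OF A(2), of \<phi>] by blast
  with that A cover_face[OF assms(2) A(1)] show ?thesis by blast
qed

lemma cover_apex:
  assumes "c \<in> {1..k}" "\<rho> \<in> faces T (int d - 1)" "v \<notin> \<rho>" "insert v \<rho> \<in> CT c"
  shows "\<phi> v = apex (CX c) (\<phi> ` \<rho>)"
proof (rule cod.apex_unique(2)[OF assms(1) cover_ridge(2)[OF assms(2)]])
  note c = cover_face[OF assms(1,4)]
  show "insert (\<phi> v) (\<phi> ` \<rho>) \<in> CX c" using c by simp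
  show "\<phi> v \<notin> \<phi> ` \<rho>" using c assms(3) by auto
qed

text \<open>Walks lift step by step: \<open>lift_face\<close> supplies a face over the current step,
  and \<open>\<phi>\<close> is injective on it, so the next ridge has one preimage there. Different
  ridges upstairs may still have the same image.\<close>

lemma walk_image:
  assumes \<tau>: "\<tau> \<in> faces T (int d - 1)"
  shows "{\<sigma>. (\<phi> ` \<tau>, \<sigma>) \<in> line_graph d X ^^ m} = (`) \<phi> ` {\<rho>. (\<tau>, \<rho>) \<in> line_graph d T ^^ m}"
proof (induction m)
  case 0
  then show ?case by auto
next
  case (Suc m)
  show ?case
  proof (intro set_eqI iffI)
    fix \<sigma> assume "\<sigma> \<in> {\<sigma>. (\<phi> ` \<tau>, \<sigma>) \<in> line_graph d X ^^ Suc m}"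
    then obtain \<sigma>' where \<sigma>': "(\<phi> ` \<tau>, \<sigma>') \<in> line_graph d X ^^ m" "(\<sigma>', \<sigma>) \<in> line_graph d X"
      by auto
    then have "\<sigma>' \<in> (`) \<phi> ` {\<rho>. (\<tau>, \<rho>) \<in> line_graph d T ^^ m}" unfolding Suc[symmetric] by blast
    then obtain \<rho>' where \<rho>': "(\<tau>, \<rho>') \<in> line_graph d T ^^ m" "\<sigma>' = \<phi> ` \<rho>'" by blast
    obtain c A' where A': "c \<in> {1..k}" "A' \<in> CX c" "\<sigma>' \<subseteq> A'" "\<sigma> \<subseteq> A'" "card \<sigma> = d" "\<sigma>' \<noteq> \<sigma>"
      using cod.line_graph_face[OF \<sigma>'(2)] by metis
    have \<rho>T: "\<rho>' \<in> faces T (int d - 1)" by (rule dom.walk_ridge[OF \<tau> \<rho>'(1)])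
    obtain A where A: "A \<in> CT c" "\<rho>' \<subseteq> A" "\<phi> ` A = A'" "inj_on \<phi> A"
      using lift_face[OF \<rho>T A'(1,2)] A'(3) \<rho>'(2) by blast
    obtain \<rho> where \<rho>: "\<rho> \<subseteq> A" "\<phi> ` \<rho> = \<sigma>" using A(3) A'(4) by (metis subset_imageE)
    have "card \<rho> = d" using \<rho> A(4) A'(5) by (metis card_image inj_on_subset)
    then have "(\<rho>', \<rho>) \<in> line_graph d T"
      using dom.line_graphI(1)[OF A'(1) A(1,2) \<rho>(1)] \<rho>T \<rho>(2) \<rho>'(2) A'(6) dom.ridge_iff by blast
    then show "\<sigma> \<in> (`) \<phi> ` {\<rho>. (\<tau>, \<rho>) \<in> line_graph d T ^^ Suc m}" using \<rho>'(1) \<rho>(2) by auto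
  next
    fix \<sigma> assume "\<sigma> \<in> (`) \<phi> ` {\<rho>. (\<tau>, \<rho>) \<in> line_graph d T ^^ Suc m}"
    then obtain \<rho>' \<rho> where \<rho>: "(\<tau>, \<rho>') \<in> line_graph d T ^^ m" "(\<rho>', \<rho>) \<in> line_graph d T"
      "\<sigma> = \<phi> ` \<rho>" by auto
    obtain c A where A: "c \<in> {1..k}" "A \<in> CT c" "\<rho>' \<subseteq> A" "\<rho> \<subseteq> A" "card \<rho> = d" "\<rho>' \<noteq> \<rho>"
      "\<rho>' \<in> faces T (int d - 1)" "\<rho> \<in> faces T (int d - 1)"
      using dom.line_graph_face[OF \<rho>(2)] by metis
    note cA = cover_face[OF A(1,2)]
    have "\<phi> ` \<rho>' \<noteq> \<phi> ` \<rho>" using cA A(3,4,6) by (metis inj_on_image_eq_iff)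
    then have "(\<phi> ` \<rho>', \<phi> ` \<rho>) \<in> line_graph d X"
      using cod.line_graphI(1)[OF A(1), of "\<phi> ` A" "\<phi> ` \<rho>'" "\<phi> ` \<rho>"] cA A(3,4)
        cover_ridge(2)[OF A(7)] cover_ridge(2)[OF A(8)] cod.ridge_iff by (meson image_mono)
    moreover have "(\<phi> ` \<tau>, \<phi> ` \<rho>') \<in> line_graph d X ^^ m" using Suc \<rho>(1) by blast
    ultimately show "\<sigma> \<in> {\<sigma>. (\<phi> ` \<tau>, \<sigma>) \<in> line_graph d X ^^ Suc m}" using \<rho>(3) by auto
  qed
qed

lemma line_ball_image:
  assumes \<tau>: "\<tau> \<in> faces T (int d - 1)"
  shows "line_ball d X (\<phi> ` \<tau>) r = (`) \<phi> ` line_ball d T \<tau> r"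
proof -
  have *: "line_ball d Y \<sigma> r = (\<Union>m\<in>{m. real m \<le> r}. {\<rho>. (\<sigma>, \<rho>) \<in> line_graph d Y ^^ m})"
    if "coloured_complex d k Y CY" "\<sigma> \<in> faces Y (int d - 1)" for Y :: "'c set set" and CY \<sigma>
    using coloured_complex.walk_ridge[OF that] by (auto simp: line_ball_iff)
  show ?thesis
    unfolding *[OF dom.coloured_complex_axioms \<tau>]
      *[OF cod.coloured_complex_axioms cover_ridge(2)[OF \<tau>]] walk_image[OF \<tau>]
    by (simp add: image_UN)
qed

text \<open>Injectivity is asked for on all \<open>d\<close>-faces touching the ball. A
  \<open>d\<close>-face of \<open>X\<close> whose ridges are images of ball ridges lifts at first
  only to a face that touches the ball; its ridges are recognised as ball ridges because
  \<open>\<phi>\<close> separates them.\<close>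

lemma nbhd_iso:
  assumes \<tau>: "\<tau> \<in> faces T (int d - 1)"
    and inj: "inj_on \<phi> (\<Union>{A \<in> faces T (int d). \<exists>\<rho>\<in>line_ball d T \<tau> r. \<rho> \<subseteq> A})"
  shows "simplicial_iso (nbhd_complex d T \<tau> r) (nbhd_complex d X (\<phi> ` \<tau>) r)"
proof -
  let ?B = "line_ball d T \<tau> r"
  define U where "U = \<Union>{A \<in> faces T (int d). \<exists>\<rho>\<in>?B. \<rho> \<subseteq> A}"
  have injU: "inj_on \<phi> U" using inj by (simp add: U_def)
  let ?NT = "{A \<in> faces T (int d). \<forall>\<sigma>. \<sigma> \<subseteq> A \<and> card \<sigma> = d \<longrightarrow> \<sigma> \<in> ?B}"
  let ?NX = "{A \<in> faces X (int d). \<forall>\<sigma>. \<sigma> \<subseteq> A \<and> card \<sigma> = d \<longrightarrow> \<sigma> \<in> (`) \<phi> ` ?B}"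
  have BU: "\<rho> \<subseteq> U" if "\<rho> \<in> ?B" for \<rho>
  proof -
    have 1: "1 \<in> {1..k}" using dom.k_pos by simp
    have "\<rho> \<in> faces T (int d - 1)" using that by (simp add: line_ball_iff)
    then obtain A where "A \<in> CT 1" "\<rho> \<subseteq> A" using dom.ex1_face[OF 1] by blast
    then show ?thesis using that dom.coloured_faceD(4)[OF 1] unfolding U_def by blast
  qed
  have sub: "\<exists>\<sigma>. \<sigma> \<subseteq> A \<and> card \<sigma> = d" if "finite A" "card A = Suc d" for A :: "'c set"
    using obtain_subset_with_card_n[of d A] that by auto
  have NTU: "A \<subseteq> U" if A: "A \<in> ?NT" for A
  proof -
    have "finite A" "card A = Suc d" using A by (auto simp: faces_def)
    then obtain \<sigma> where "\<sigma> \<subseteq> A" "card \<sigma> = d" using sub by blast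
    with A show ?thesis unfolding U_def by blast
  qed
  have NX: "?NX = (`) \<phi> ` ?NT"
  proof (intro set_eqI iffI)
    fix A' assume A': "A' \<in> ?NX"
    then obtain c where c: "c \<in> {1..k}" "A' \<in> CX c" using cod.top_faces by blast
    have "finite A'" "card A' = Suc d" using A' by (auto simp: faces_def)
    then obtain \<sigma> where \<sigma>: "\<sigma> \<subseteq> A'" "card \<sigma> = d" using sub by blast
    then obtain \<rho> where \<rho>: "\<rho> \<in> ?B" "\<sigma> = \<phi> ` \<rho>" using A' by blast
    then have "\<rho> \<in> faces T (int d - 1)" by (simp add: line_ball_iff)
    then obtain A where A: "A \<in> CT c" "\<rho> \<subseteq> A" "\<phi> ` A = A'" "inj_on \<phi> A"
      using lift_face[OF _ c] \<sigma>(1) \<rho>(2) by blast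
    have AU: "A \<subseteq> U" unfolding U_def using dom.coloured_faceD(4)[OF c(1) A(1)] A(2) \<rho>(1) by blast
    have "\<rho>' \<in> ?B" if \<rho>': "\<rho>' \<subseteq> A" "card \<rho>' = d" for \<rho>'
    proof -
      have "\<phi> ` \<rho>' \<subseteq> A'" "card (\<phi> ` \<rho>') = d"
        using \<rho>' A(3,4) by (auto simp: card_image inj_on_subset)
      then obtain \<rho>'' where "\<rho>'' \<in> ?B" "\<phi> ` \<rho>' = \<phi> ` \<rho>''" using A' by blast
      moreover from this have "\<rho>' = \<rho>''"
        using injU \<rho>'(1) AU BU by (metis inj_on_image_eq_iff order_trans)
      ultimately show ?thesis by simp
    qed
    then show "A' \<in> (`) \<phi> ` ?NT" using A(1,3) dom.coloured_faceD(4)[OF c(1)] by blast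
  next
    fix A' assume "A' \<in> (`) \<phi> ` ?NT"
    then obtain A where A: "A \<in> ?NT" "A' = \<phi> ` A" by blast
    then obtain c where c: "c \<in> {1..k}" "A \<in> CT c" using dom.top_faces by blast
    note cA = cover_face[OF c]
    have "\<sigma> \<in> (`) \<phi> ` ?B" if \<sigma>: "\<sigma> \<subseteq> A'" "card \<sigma> = d" for \<sigma>
    proof -
      obtain \<rho> where \<rho>: "\<rho> \<subseteq> A" "\<sigma> = \<phi> ` \<rho>" using \<sigma>(1) A(2) by (metis subset_imageE)
      then have "card \<rho> = d" using cA \<sigma>(2) by (metis card_image inj_on_subset)
      then show ?thesis using \<rho> A(1) by blast
    qed
    then show "A' \<in> ?NX" using cA A(2) cod.coloured_faceD(4)[OF c(1)] by blast
  qed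
  have im: "nbhd_complex d X (\<phi> ` \<tau>) r = (`) \<phi> ` nbhd_complex d T \<tau> r"
  proof -
    have "(\<Union>\<sigma>\<in>(`) \<phi> ` ?B. Pow \<sigma>) = (`) \<phi> ` (\<Union>\<sigma>\<in>?B. Pow \<sigma>)"
      by (simp add: image_UN image_Pow_surj)
    then show ?thesis
      unfolding cod.nbhd_complex_eq dom.nbhd_complex_eq line_ball_image[OF \<tau>] NX image_Un by simp
  qed
  have NU: "nbhd_complex d T \<tau> r \<subseteq> Pow U"
    unfolding dom.nbhd_complex_eq using BU NTU by blast
  have "inj_on ((`) \<phi>) (nbhd_complex d T \<tau> r)"
    using inj_on_image_Pow[OF injU] NU by (rule inj_on_subset)
  then have "bij_betw (\<lambda>\<sigma>. \<phi> ` \<sigma>) (nbhd_complex d T \<tau> r) (nbhd_complex d X (\<phi> ` \<tau>) r)"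
    using im by (simp add: bij_betw_def)
  moreover have "bij_betw \<phi> (\<Union>(nbhd_complex d T \<tau> r)) (\<Union>(nbhd_complex d X (\<phi> ` \<tau>) r))"
    unfolding bij_betw_def im using inj_on_subset[OF injU, of "\<Union>(nbhd_complex d T \<tau> r)"] NU by blast
  ultimately show ?thesis unfolding simplicial_iso_def by blast
qed

end

lemma simplicial_iso_sym:
  assumes "simplicial_iso X Y" shows "simplicial_iso Y X"
proof -
  obtain f where f: "bij_betw f (\<Union>X) (\<Union>Y)" "bij_betw (\<lambda>\<sigma>. f ` \<sigma>) X Y"
    using assms unfolding simplicial_iso_def by blast
  let ?g = "inv_into (\<Union>X) f"
  have fg: "?g ` f ` \<sigma> = \<sigma>" if "\<sigma> \<in> X" for \<sigma>
    using that f(1) by (intro inv_into_image_cancel) (auto simp: bij_betw_def)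
  have "bij_betw (\<lambda>\<sigma>. ?g ` \<sigma>) Y X"
  proof (rule bij_betw_byWitness[where f' = "\<lambda>\<sigma>. f ` \<sigma>"])
    have Y: "Y = (\<lambda>\<sigma>. f ` \<sigma>) ` X" using f(2) by (simp add: bij_betw_def)
    show "\<forall>\<sigma>\<in>Y. f ` ?g ` \<sigma> = \<sigma>" unfolding Y using fg by simp
    show "(\<lambda>\<sigma>. ?g ` \<sigma>) ` Y \<subseteq> X" unfolding Y using fg by auto
  qed (use f(2) fg in \<open>auto simp: bij_betw_def\<close>)
  then show ?thesis using bij_betw_inv_into[OF f(1)] unfolding simplicial_iso_def by blast
qed

lemma simplicial_iso_trans:
  assumes "simplicial_iso X Y" "simplicial_iso Y Z" shows "simplicial_iso X Z"
proof -
  obtain f g where "bij_betw f (\<Union>X) (\<Union>Y)" "bij_betw (\<lambda>\<sigma>. f ` \<sigma>) X Y"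
    "bij_betw g (\<Union>Y) (\<Union>Z)" "bij_betw (\<lambda>\<sigma>. g ` \<sigma>) Y Z"
    using assms unfolding simplicial_iso_def by blast
  then have "bij_betw (g \<circ> f) (\<Union>X) (\<Union>Z)" "bij_betw ((\<lambda>\<sigma>. g ` \<sigma>) \<circ> (\<lambda>\<sigma>. f ` \<sigma>)) X Z"
    using bij_betw_trans by blast+
  then show ?thesis unfolding simplicial_iso_def by (auto simp: comp_def image_image)
qed

section \<open>Combinatorics of the arboreal complex\<close>

text \<open>Justifies the recursions below through the finite set stored in
  \<open>Apex\<close>.\<close>

lemma size_fset_mem [termination_simp]:
  "x |\<in>| F \<Longrightarrow> size x < Suc (\<Sum>x\<in>fset F. Suc (size x))"
  using member_le_sum[of x "fset F" "\<lambda>x. Suc (size x)"] by auto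

text \<open>A birth order replacing the stage number: it increases strictly from a ridge to the
  vertices attached to it. Base vertices get distinct ranks so that every ridge has exactly one
  newest vertex.\<close>

fun rk :: "tree_vertex \<Rightarrow> nat" where
  "rk (Base i) = i"
| "rk (Apex F j) = Suc (Max (rk ` fset F))"

definition newest :: "tree_vertex set \<Rightarrow> tree_vertex set" where
  "newest F = {q \<in> F. \<forall>x\<in>F. x \<noteq> q \<longrightarrow> rk x < rk q}"

text \<open>Enumerates the positive colours other than \<open>c\<close> in increasing order,
  starting from \<open>j = 0\<close>.\<close>

definition skip :: "nat \<Rightarrow> nat \<Rightarrow> nat" where
  "skip c j = (if Suc j < c then Suc j else Suc (Suc j))"

text \<open>The colour of a non-base vertex is that of the \<open>d\<close>-face it was created with. The vertices
  attached to a \<open>(d-1)\<close>-face avoid the colour of its newest vertex, which is the colour of the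
  \<open>d\<close>-face that this \<open>(d-1)\<close>-face was created with.\<close>

fun col :: "tree_vertex \<Rightarrow> nat" where
  "col (Base i) = 1"
| "col (Apex F j) = skip (the_elem (col ` {q \<in> fset F. \<forall>x\<in>fset F. x \<noteq> q \<longrightarrow> rk x < rk q})) j"

declare col.simps(2) [simp del]

text \<open>The base ridge gets the value 1 from its newest vertex \<open>Base (d - 1)\<close>; its
  kid \<open>Base d\<close> has that very colour, so the initial \<open>d\<close>-face is of colour
  1.\<close>

definition pcol :: "tree_vertex set \<Rightarrow> nat" where
  "pcol F = the_elem (col ` newest F)"

definition base_ridge :: "nat \<Rightarrow> tree_vertex set" where
  "base_ridge d = Base ` {..<d}"

fun par :: "nat \<Rightarrow> tree_vertex \<Rightarrow> tree_vertex set" where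
  "par d (Base i) = base_ridge d"
| "par d (Apex F j) = fset F"

text \<open>Treating \<open>Base d\<close> as attached to the base ridge makes every \<open>d\<close>-face one of the
  form \<open>insert q F\<close> with \<open>q\<close> a kid of \<open>F\<close>.\<close>

definition kids :: "nat \<Rightarrow> nat \<Rightarrow> tree_vertex set \<Rightarrow> tree_vertex set" where
  "kids d k F = (if F = base_ridge d then {Base d} else {}) \<union> Apex (Abs_fset F) ` {..<k - 1}"

text \<open>A description of the \<open>(d-1)\<close>-faces without stages. The condition
  \<open>q \<in> B\<close> makes \<open>q\<close> the newest vertex of \<open>B\<close>; the only
  other \<open>d\<close>-subset of \<open>insert q F\<close> is \<open>F\<close> itself.\<close>

inductive_set ridges :: "nat \<Rightarrow> nat \<Rightarrow> tree_vertex set set" for d k where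
  base_ridge: "base_ridge d \<in> ridges d k"
| step: "F \<in> ridges d k \<Longrightarrow> q \<in> kids d k F \<Longrightarrow> B \<subseteq> insert q F \<Longrightarrow> q \<in> B \<Longrightarrow> card B = d
    \<Longrightarrow> B \<in> ridges d k"

definition tree_faces :: "nat \<Rightarrow> nat \<Rightarrow> nat \<Rightarrow> tree_vertex set set" where
  "tree_faces d k c = {insert q F | q F. F \<in> ridges d k \<and> q \<in> kids d k F \<and> col q = c}"

lemma col_Apex: "col (Apex F j) = skip (pcol (fset F)) j"
  by (simp add: col.simps(2) pcol_def newest_def)

lemma skip_neq: "skip c j \<noteq> c"
  by (auto simp: skip_def)

lemma skip_inj: "skip c i = skip c j \<Longrightarrow> i = j"
  by (auto simp: skip_def split: if_splits)

lemma skip_range: "j < k - 1 \<Longrightarrow> skip c j \<in> {1..k}"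
  by (auto simp: skip_def)

lemma skip_surj:
  assumes "x \<in> {1..k}" "c \<in> {1..k}" "x \<noteq> c"
  obtains j where "j < k - 1" "skip c j = x"
proof (cases "x < c")
  case True
  then show ?thesis using assms that[of "x - 1"] by (auto simp: skip_def)
next
  case False
  then have "c < x" using assms(3) by simp
  then obtain y where "x = Suc (Suc y)" using assms(2) by (cases x; cases "x - 1") auto
  with \<open>c < x\<close> show ?thesis using assms that[of y] by (auto simp: skip_def)
qed

lemma finite_root [simp]: "finite (base_ridge d)" and card_root [simp]: "card (base_ridge d) = d"
  by (simp_all add: base_ridge_def card_image inj_on_def)

lemma rk_newest_unique:
  assumes "q \<in> B" "\<And>x. x \<in> B \<Longrightarrow> x \<noteq> q \<Longrightarrow> rk x < rk q"
  shows "newest B = {q}"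
proof -
  have "x = q" if "x \<in> newest B" for x
    using that assms unfolding newest_def by (metis (mono_tags, lifting) less_asym mem_Collect_eq)
  then show ?thesis using assms by (auto simp: newest_def)
qed

locale arboreal_params =
  fixes d k :: nat
  assumes d_pos: "d \<ge> 1" and k_pos: "k \<ge> 1"
begin

lemma ridge_finite: "F \<in> ridges d k \<Longrightarrow> finite F" and ridge_card: "F \<in> ridges d k \<Longrightarrow> card F = d"
proof -
  show c: "F \<in> ridges d k \<Longrightarrow> card F = d" for F by (induction rule: ridges.induct) auto
  show "finite F" if "F \<in> ridges d k"
    using c[OF that] d_pos by (metis card.infinite not_one_le_zero)
qed

lemma fset_Abs_ridge: "F \<in> ridges d k \<Longrightarrow> fset (Abs_fset F) = F"
  using ridge_finite by (simp add: Abs_fset_inverse)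

lemma par_kids: "F \<in> ridges d k \<Longrightarrow> q \<in> kids d k F \<Longrightarrow> par d q = F"
  by (auto simp: kids_def fset_Abs_ridge split: if_splits)

lemma rk_kids:
  assumes "F \<in> ridges d k" "q \<in> kids d k F" "x \<in> F"
  shows "rk x < rk q"
proof -
  have "rk x \<le> Max (rk ` F)" using assms ridge_finite by simp
  moreover have "rk q = d \<and> F = base_ridge d \<or> rk q = Suc (Max (rk ` F))"
  proof (cases "q = Base d \<and> F = base_ridge d")
    case False
    then obtain j where "q = Apex (Abs_fset F) j"
      using assms(2) by (auto simp: kids_def split: if_splits)
    then show ?thesis using fset_Abs_ridge[OF assms(1)] by simp
  qed simp
  moreover have "rk x < d" if "F = base_ridge d" using assms(3) that by (auto simp: base_ridge_def)
  ultimately show ?thesis by linarith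
qed

lemma kids_notin: "F \<in> ridges d k \<Longrightarrow> q \<in> kids d k F \<Longrightarrow> q \<notin> F"
  using rk_kids by blast

lemma kids_notin_root: "q \<in> kids d k F \<Longrightarrow> q \<notin> base_ridge d"
  by (auto simp: kids_def base_ridge_def split: if_splits)

lemma newest_kids:
  assumes "F \<in> ridges d k" "q \<in> kids d k F" "B \<subseteq> insert q F" "q \<in> B"
  shows "newest B = {q}"
  using assms by (intro rk_newest_unique) (auto intro: rk_kids)

lemma newest_root: "newest (base_ridge d) = {Base (d - 1)}"
  using d_pos by (intro rk_newest_unique) (auto simp: base_ridge_def)

lemma newest_ridge:
  assumes "B \<in> ridges d k"
  obtains q where "newest B = {q}" "q \<in> B" "\<And>x. x \<in> B \<Longrightarrow> x \<noteq> q \<Longrightarrow> rk x < rk q"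
proof -
  have "\<exists>q. newest B = {q}"
    using assms
  proof cases
    case base_ridge
    then show ?thesis using newest_root by simp
  next
    case (step F q)
    then show ?thesis using newest_kids[of F q B] by simp
  qed
  with that show ?thesis unfolding newest_def by blast
qed

lemma ridge_cases:
  assumes "B \<in> ridges d k" "B \<noteq> base_ridge d"
  obtains q where "par d q \<in> ridges d k" "q \<in> kids d k (par d q)" "q \<in> B" "newest B = {q}"
    "B \<subseteq> insert q (par d q)"
  using assms(1)
proof cases
  case (step F q)
  then show ?thesis using that[of q] newest_kids[of F q B] par_kids by auto
qed (use assms(2) in auto)

lemma ridge_subI:
  assumes "F \<in> ridges d k" "q \<in> kids d k F" "B \<subseteq> insert q F" "card B = d"
  shows "B \<in> ridges d k"
proof (cases "q \<in> B")
  case True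
  show ?thesis by (rule ridges.step[OF assms(1-3) True assms(4)])
next
  case False
  then have "B = F" using assms ridge_card ridge_finite by (intro card_subset_eq) auto
  then show ?thesis using assms by simp
qed

lemma col_range: "F \<in> ridges d k \<Longrightarrow> q \<in> kids d k F \<Longrightarrow> col q \<in> {1..k}"
  using skip_range[of _ k] k_pos by (auto simp: kids_def col_Apex split: if_splits)

lemma pcol_root: "pcol (base_ridge d) = 1"
  by (simp add: pcol_def newest_root)

lemma pcol_newest: "newest B = {q} \<Longrightarrow> pcol B = col q"
  by (simp add: pcol_def)

lemma pcol_range:
  assumes "B \<in> ridges d k" shows "pcol B \<in> {1..k}"
proof (cases "B = base_ridge d")
  case True
  then show ?thesis using pcol_root k_pos by simp
next
  case False
  with assms obtain q where "par d q \<in> ridges d k" "q \<in> kids d k (par d q)" "newest B = {q}"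
    by (rule ridge_cases)
  then show ?thesis using col_range pcol_newest by metis
qed

lemma col_kids_neq: "F \<in> ridges d k \<Longrightarrow> F \<noteq> base_ridge d \<Longrightarrow> q \<in> kids d k F \<Longrightarrow> col q \<noteq> pcol F"
  by (auto simp: kids_def col_Apex fset_Abs_ridge skip_neq)

lemma col_kids_inj:
  assumes "F \<in> ridges d k" "q \<in> kids d k F" "q' \<in> kids d k F" "col q = col q'"
  shows "q = q'"
  using assms skip_neq[of 1] pcol_root
  by (auto simp: kids_def col_Apex fset_Abs_ridge split: if_splits dest: skip_inj) metis+

lemma kid_of_col:
  assumes F: "F \<in> ridges d k" and c: "c \<in> {1..k}" and ne: "F = base_ridge d \<or> c \<noteq> pcol F"
  obtains q where "q \<in> kids d k F" "col q = c"
proof (cases "c = pcol F")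
  case True
  then show ?thesis using ne that[of "Base d"] pcol_root by (auto simp: kids_def)
next
  case False
  then obtain j where "j < k - 1" "skip (pcol F) j = c"
    using skip_surj[OF c pcol_range[OF F]] by blast
  then show ?thesis
    using that[of "Apex (Abs_fset F) j"] fset_Abs_ridge[OF F] by (auto simp: kids_def col_Apex)
qed

text \<open>A ridge \<open>B\<close> lies in \<open>insert q F\<close> in two ways only:
  \<open>B = F\<close> and \<open>q\<close> is a kid of \<open>B\<close>, or \<open>q\<close> is the
  newest vertex of \<open>B\<close> and \<open>F\<close> the parent of \<open>q\<close>. Kids carry
  every colour except \<open>pcol B\<close> once, and the newest vertex carries
  \<open>pcol B\<close>. For the base ridge the second way does not occur, and the kid
  \<open>Base d\<close> fills the gap.\<close>

lemma tree_face_ex1: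
  assumes B: "B \<in> ridges d k" and c: "c \<in> {1..k}"
  shows "\<exists>!A. A \<in> tree_faces d k c \<and> B \<subseteq> A"
proof -
  have cases: "if q \<in> B then newest B = {q} \<and> B \<noteq> base_ridge d else B = F"
    if "F \<in> ridges d k" "q \<in> kids d k F" "B \<subseteq> insert q F" for q F
  proof (cases "q \<in> B")
    case True
    then show ?thesis using newest_kids[OF that] kids_notin_root[OF that(2)] by auto
  next
    case False
    then have "B = F"
      using that ridge_card[OF B] ridge_card[of F] ridge_finite by (intro card_subset_eq) auto
    with False show ?thesis by simp
  qed
  show ?thesis
  proof (cases "B = base_ridge d \<or> c \<noteq> pcol B")
    case True
    then obtain q where q: "q \<in> kids d k B" "col q = c" using kid_of_col[OF B c] by blast
    show ?thesis
    proof (intro ex1I conjI)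
      show "insert q B \<in> tree_faces d k c" using B q by (auto simp: tree_faces_def)
      fix A assume "A \<in> tree_faces d k c \<and> B \<subseteq> A"
      then obtain q' F where A: "A = insert q' F" "F \<in> ridges d k" "q' \<in> kids d k F" "col q' = c"
        "B \<subseteq> insert q' F" by (auto simp: tree_faces_def)
      have "q' \<notin> B" using cases[OF A(2,3,5)] True A(4) pcol_newest by auto
      then have "F = B" using cases[OF A(2,3,5)] by simp
      then show "A = insert q B" using col_kids_inj[OF B q(1)] A q(2) by auto
    qed auto
  next
    case False
    obtain q where q: "par d q \<in> ridges d k" "q \<in> kids d k (par d q)" "q \<in> B" "newest B = {q}"
      "B \<subseteq> insert q (par d q)"
      using ridge_cases[OF B] False by blast
    have cq: "col q = c" using False pcol_newest[OF q(4)] by simp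
    show ?thesis
    proof (intro ex1I conjI)
      show "insert q (par d q) \<in> tree_faces d k c" using q cq by (auto simp: tree_faces_def)
      show "B \<subseteq> insert q (par d q)" by (rule q(5))
      fix A assume "A \<in> tree_faces d k c \<and> B \<subseteq> A"
      then obtain q' F where A: "A = insert q' F" "F \<in> ridges d k" "q' \<in> kids d k F" "col q' = c"
        "B \<subseteq> insert q' F" by (auto simp: tree_faces_def)
      have "q' \<in> B" using cases[OF A(2,3,5)] False A(2-4) col_kids_neq[of B q'] by fastforce
      then have "q' = q" using cases[OF A(2,3,5)] q(4) by auto
      then show "A = insert q (par d q)" using A par_kids by auto
    qed
  qed
qed

section \<open>Agreement of the staged construction with the recursive description\<close>

lemma stage_sub:
  "(\<forall>A \<in> fst (arboreal_stage d k m). \<exists>F\<in>ridges d k. \<exists>q\<in>kids d k F. A \<subseteq> insert q F)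
    \<and> snd (arboreal_stage d k m) \<subseteq> ridges d k"
proof (induction m)
  case 0
  have K: "Base d \<in> kids d k (base_ridge d)" by (simp add: kids_def)
  have b: "Base ` {0..d} = insert (Base d) (base_ridge d)"
  proof -
    have "{0..d} = insert d {..<d}" by auto
    then show ?thesis by (simp add: base_ridge_def)
  qed
  show ?case
    unfolding arboreal_stage.simps b
    using ridges.base_ridge K ridge_subI[OF ridges.base_ridge K] by (auto simp: faces_def)
next
  case (Suc m)
  obtain Y F where YF: "arboreal_stage d k m = (Y, F)" by fastforce
  have att: "\<exists>F\<in>ridges d k. \<exists>q\<in>kids d k F. A \<subseteq> insert q F" if A: "A \<in> attach k \<sigma>" and \<sigma>: "\<sigma> \<in> F" for A \<sigma>
  proof -
    obtain j where "j < k - 1" "A \<subseteq> insert (Apex (Abs_fset \<sigma>) j) \<sigma>"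
      using A by (auto simp: attach_def)
    then have "Apex (Abs_fset \<sigma>) j \<in> kids d k \<sigma>" "A \<subseteq> insert (Apex (Abs_fset \<sigma>) j) \<sigma>"
      by (auto simp: kids_def)
    moreover have "\<sigma> \<in> ridges d k" using \<sigma> Suc YF by auto
    ultimately show ?thesis by blast
  qed
  then have *: "\<exists>F\<in>ridges d k. \<exists>q\<in>kids d k F. A \<subseteq> insert q F" if "A \<in> Y \<union> (\<Union>\<sigma>\<in>F. attach k \<sigma>)" for A
    using that Suc YF by auto
  moreover have "faces (Y \<union> (\<Union>\<sigma>\<in>F. attach k \<sigma>)) (int d - 1) \<subseteq> ridges d k"
  proof
    fix B assume "B \<in> faces (Y \<union> (\<Union>\<sigma>\<in>F. attach k \<sigma>)) (int d - 1)"
    then have "B \<in> Y \<union> (\<Union>\<sigma>\<in>F. attach k \<sigma>)" "card B = d" by (auto simp: faces_def)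
    then show "B \<in> ridges d k" using *[of B] ridge_subI by blast
  qed
  ultimately show ?case by (auto simp: YF Let_def)
qed

text \<open>A ridge is listed as created at the first stage that contains it, so its kids do get
  attached one step later.\<close>

lemma stage_new:
  assumes "B \<in> faces (fst (arboreal_stage d k m)) (int d - 1)"
  shows "\<exists>m. B \<in> snd (arboreal_stage d k m)"
  using assms
proof (induction m)
  case 0
  then have "B \<in> snd (arboreal_stage d k 0)" by simp
  then show ?case by blast
next
  case (Suc m)
  show ?case
  proof (cases "B \<in> faces (fst (arboreal_stage d k m)) (int d - 1)")
    case False
    with Suc.prems have "B \<in> snd (arboreal_stage d k (Suc m))"
      by (auto simp: Let_def case_prod_beta)
    then show ?thesis by blast
  qed (use Suc.IH in blast)
qed

lemma tree_face_in_arboreal: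
  assumes "F \<in> ridges d k" "q \<in> kids d k F" "A \<subseteq> insert q F"
  shows "A \<in> arboreal d k"
proof -
  have base: "A \<in> arboreal d k" if "A \<subseteq> insert (Base d) (base_ridge d)" for A
  proof -
    have "A \<in> fst (arboreal_stage d k 0)" using that by (auto simp: base_ridge_def)
    then show ?thesis unfolding arboreal_def by blast
  qed
  have att: "A \<in> arboreal d k" if F: "F \<in> ridges d k" "F \<in> arboreal d k" and q: "q \<in> kids d k F"
    and A: "A \<subseteq> insert q F" for A F q
  proof (cases "q = Base d \<and> F = base_ridge d")
    case True
    then show ?thesis using base A by blast
  next
    case False
    then obtain j where j: "j < k - 1" "q = Apex (Abs_fset F) j"
      using q by (auto simp: kids_def split: if_splits)
    obtain m where "F \<in> faces (fst (arboreal_stage d k m)) (int d - 1)"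
      using F ridge_card ridge_finite by (auto simp: arboreal_def faces_def)
    then obtain m where "F \<in> snd (arboreal_stage d k m)" using stage_new by blast
    moreover have "A \<in> attach k F" using A j by (auto simp: attach_def)
    ultimately have "A \<in> fst (arboreal_stage d k (Suc m))" by (auto simp: Let_def case_prod_beta)
    then show ?thesis unfolding arboreal_def by blast
  qed
  have "F \<in> arboreal d k" using assms(1)
  proof induction
    case base_ridge
    then show ?case using base by blast
  next
    case (step F q B)
    then show ?case using att by blast
  qed
  then show ?thesis using att assms by blast
qed

lemma arboreal_eq: "arboreal d k = {A. \<exists>F\<in>ridges d k. \<exists>q\<in>kids d k F. A \<subseteq> insert q F}"
proof (intro set_eqI iffI)
  fix A assume "A \<in> arboreal d k"
  then obtain m where "A \<in> fst (arboreal_stage d k m)" by (auto simp: arboreal_def)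
  then show "A \<in> {A. \<exists>F\<in>ridges d k. \<exists>q\<in>kids d k F. A \<subseteq> insert q F}"
    using stage_sub[of m] by simp
qed (use tree_face_in_arboreal in blast)

lemma ridge_in_tree_face:
  assumes "F \<in> ridges d k" obtains A where "A \<in> tree_faces d k 1" "F \<subseteq> A"
  using tree_face_ex1[OF assms, of 1] k_pos by auto

lemma faces_arboreal: "faces (arboreal d k) (int d - 1) = ridges d k"
proof (intro set_eqI iffI)
  fix B assume "B \<in> faces (arboreal d k) (int d - 1)"
  then have "B \<in> arboreal d k" "card B = d" by (auto simp: faces_def)
  then show "B \<in> ridges d k" using ridge_subI unfolding arboreal_eq by blast
next
  fix B assume B: "B \<in> ridges d k"
  obtain A where "A \<in> tree_faces d k 1" "B \<subseteq> A" using ridge_in_tree_face[OF B] .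
  then have "B \<in> arboreal d k" unfolding arboreal_eq tree_faces_def by auto
  then show "B \<in> faces (arboreal d k) (int d - 1)"
    using B ridge_card ridge_finite by (simp add: faces_def)
qed

lemma top_faces_arboreal: "faces (arboreal d k) (int d) = (\<Union>c\<in>{1..k}. tree_faces d k c)"
proof (intro set_eqI iffI)
  fix A assume "A \<in> faces (arboreal d k) (int d)"
  then obtain F q where A: "F \<in> ridges d k" "q \<in> kids d k F" "A \<subseteq> insert q F" "card A = Suc d"
    by (auto simp: faces_def arboreal_eq)
  have "A = insert q F"
    using A kids_notin[OF A(1,2)] ridge_card[OF A(1)] ridge_finite[OF A(1)]
    by (intro card_subset_eq) auto
  then show "A \<in> (\<Union>c\<in>{1..k}. tree_faces d k c)"
    using A col_range[OF A(1,2)] unfolding tree_faces_def by blast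
next
  fix A assume "A \<in> (\<Union>c\<in>{1..k}. tree_faces d k c)"
  then obtain F q where A: "F \<in> ridges d k" "q \<in> kids d k F" "A = insert q F"
    by (auto simp: tree_faces_def)
  then show "A \<in> faces (arboreal d k) (int d)"
    using kids_notin[OF A(1,2)] ridge_card[OF A(1)] ridge_finite[OF A(1)]
    by (auto simp: faces_def arboreal_eq)
qed

lemma coloured_arboreal: "coloured_complex d k (arboreal d k) (tree_faces d k)"
proof
  show "A \<in> arboreal d k \<Longrightarrow> B \<subseteq> A \<Longrightarrow> B \<in> arboreal d k" for A B
    unfolding arboreal_eq by (blast intro: order_trans)
  show "A \<in> arboreal d k \<Longrightarrow> finite A" for A
    unfolding arboreal_eq using ridge_finite by (auto intro: finite_subset)
qed (use d_pos k_pos top_faces_arboreal faces_arboreal tree_face_ex1 in auto)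

end

section \<open>Covers of coloured complexes by the arboreal complex\<close>

text \<open>A cover is forced by its values \<open>e\<close> on the base ridge, and the recursion
  records this: the colour of a vertex names the system in which it completes the image of its
  parent.\<close>

fun cover_map :: "nat \<Rightarrow> (nat \<Rightarrow> 'b set set) \<Rightarrow> (nat \<Rightarrow> 'b) \<Rightarrow> tree_vertex \<Rightarrow> 'b" where
  "cover_map d C e (Base i) = (if i < d then e i else apex (C 1) (e ` {..<d}))"
| "cover_map d C e (Apex F j) = apex (C (col (Apex F j))) (cover_map d C e ` fset F)"

lemma cover_map_base_ridge: "cover_map d C e ` base_ridge d = e ` {..<d}"
  by (force simp: base_ridge_def)

context arboreal_params
begin

lemma cover_map_kid:
  assumes "F \<in> ridges d k" "q \<in> kids d k F"
  shows "cover_map d C e q = apex (C (col q)) (cover_map d C e ` F)"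
proof (cases "q = Base d \<and> F = base_ridge d")
  case True
  then show ?thesis using cover_map_base_ridge[of d C e] by simp
next
  case False
  then obtain j where "q = Apex (Abs_fset F) j"
    using assms(2) by (auto simp: kids_def split: if_splits)
  then show ?thesis using fset_Abs_ridge[OF assms(1)] by simp
qed

lemma kid_face: "F \<in> ridges d k \<Longrightarrow> q \<in> kids d k F \<Longrightarrow> insert q F \<in> tree_faces d k (col q)"
  by (auto simp: tree_faces_def)

lemma cover_map_cover:
  assumes X: "coloured_complex d k X C"
    and e: "inj_on e {..<d}" "e ` {..<d} \<in> faces X (int d - 1)"
  shows "cover d k (arboreal d k) (tree_faces d k) X C (cover_map d C e)"
proof -
  interpret X: coloured_complex d k X C by (rule X)
  let ?\<phi> = "cover_map d C e"
  have kid: "inj_on ?\<phi> (insert q F) \<and> ?\<phi> ` insert q F \<in> C (col q)"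
    if F: "F \<in> ridges d k" "q \<in> kids d k F" "inj_on ?\<phi> F" "?\<phi> ` F \<in> faces X (int d - 1)" for F q
    using X.apex_unique(1)[OF col_range[OF F(1,2)] F(4)] F(3) cover_map_kid[OF F(1,2), of C e]
      kids_notin[OF F(1,2)] by simp
  have ridge: "inj_on ?\<phi> F \<and> ?\<phi> ` F \<in> faces X (int d - 1)" if "F \<in> ridges d k" for F
    using that
  proof induction
    case base_ridge
    have "inj_on ?\<phi> (base_ridge d)" using e(1) by (auto simp: base_ridge_def inj_on_def)
    then show ?case using e(2) cover_map_base_ridge[of d C e] by simp
  next
    case (step F q B)
    then have *: "inj_on ?\<phi> (insert q F)" "?\<phi> ` insert q F \<in> C (col q)" using kid by blast+
    have i: "inj_on ?\<phi> B" using *(1) step(3) by (rule inj_on_subset)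
    then have "card (?\<phi> ` B) = d" using step(5) by (simp add: card_image)
    then show ?case
      using i X.ridge_of_face[OF col_range[OF step(1,2)] *(2) image_mono[OF step(3)]] by blast
  qed
  show ?thesis
  proof (intro cover.intro cover_axioms.intro coloured_arboreal X)
    fix c A assume "A \<in> tree_faces d k c"
    then show "inj_on ?\<phi> A \<and> ?\<phi> ` A \<in> C c" using kid ridge unfolding tree_faces_def by blast
  qed
qed

text \<open>Every cover obeys the recursion of \<open>cover_map\<close>; this is the source of the
  rigidity in \<open>cover_agree\<close>.\<close>

lemma cover_kid:
  assumes "cover d k (arboreal d k) (tree_faces d k) X C \<phi>" "F \<in> ridges d k" "q \<in> kids d k F"
  shows "\<phi> q = apex (C (col q)) (\<phi> ` F)"
  using cover.cover_apex[OF assms(1) col_range[OF assms(2,3)] _ kids_notin[OF assms(2,3)]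
      kid_face[OF assms(2,3)]] assms(2) faces_arboreal by blast

text \<open>Induction towards the root: completing \<open>g\<close> on the \<open>d\<close>-face that \<open>\<tau>\<close> was created with
  prescribes the cover on the parent of \<open>\<tau>\<close>.\<close>

lemma cover_extending:
  assumes X: "coloured_complex d k X C" and \<tau>: "\<tau> \<in> ridges d k"
    and g: "inj_on g \<tau>" "g ` \<tau> \<in> faces X (int d - 1)"
  obtains \<phi> where "cover d k (arboreal d k) (tree_faces d k) X C \<phi>" "\<And>x. x \<in> \<tau> \<Longrightarrow> \<phi> x = g x"
proof -
  interpret X: coloured_complex d k X C by (rule X)
  have "\<exists>\<phi>. cover d k (arboreal d k) (tree_faces d k) X C \<phi> \<and> (\<forall>x\<in>\<tau>. \<phi> x = g x)"
    using \<tau> g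
  proof (induction arbitrary: g)
    case base_ridge
    let ?e = "\<lambda>i. g (Base i)"
    have "inj_on ?e {..<d}" using base_ridge(1) by (auto simp: base_ridge_def inj_on_def)
    moreover have "?e ` {..<d} \<in> faces X (int d - 1)"
      using base_ridge(2) by (simp add: base_ridge_def image_image)
    ultimately have "cover d k (arboreal d k) (tree_faces d k) X C (cover_map d C ?e)"
      by (rule cover_map_cover[OF X])
    moreover have "\<forall>x\<in>base_ridge d. cover_map d C ?e x = g x" by (auto simp: base_ridge_def)
    ultimately show ?case by blast
  next
    case (step F q B)
    let ?c = "col q"
    have c: "?c \<in> {1..k}" by (rule col_range[OF step(1,2)])
    \<comment> \<open>The face \<open>insert q F\<close> has one vertex outside \<open>B\<close>; a
      cover extending \<open>g\<close> has to send it to this point.\<close>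
    define a where "a = apex (C ?c) (g ` B)"
    have a: "a \<notin> g ` B" "insert a (g ` B) \<in> C ?c"
      using X.apex_unique(1)[OF c step.prems(2)] by (auto simp: a_def)
    have "card (insert q F) = Suc d" "finite (insert q F)"
      using kids_notin[OF step(1,2)] ridge_card[OF step(1)] ridge_finite[OF step(1)] by auto
    then have "card (insert q F - B) = 1"
      using step(3,5) by (simp add: card_Diff_subset finite_subset)
    then obtain u where u: "insert q F - B = {u}" by (auto simp: card_1_singleton_iff)
    let ?g = "g(u := a)"
    have uB: "insert q F = insert u B" "u \<notin> B" using u step(3) by auto
    have gB: "?g ` B = g ` B" using uB(2) by (intro image_cong) auto
    have inj: "inj_on ?g (insert q F)"
      unfolding uB(1) using step.prems(1) a(1) uB(2) gB
      by (auto simp: inj_on_insert inj_on_fun_updI)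
    have im: "?g ` insert q F \<in> C ?c" 
      using a(2) by (simp only: uB(1) image_insert gB fun_upd_same)
    have injF: "inj_on ?g F" using inj by (rule inj_on_subset) auto
    have gF: "?g ` F \<in> faces X (int d - 1)"
    proof (rule X.ridge_of_face[OF c im])
      show "card (?g ` F) = d" using card_image[OF injF] ridge_card[OF step(1)] by simp
    qed blast
    obtain \<phi> where \<phi>: "cover d k (arboreal d k) (tree_faces d k) X C \<phi>" "\<forall>x\<in>F. \<phi> x = ?g x"
      using step.IH[OF injF gF] by blast
    \<comment> \<open>The induction hypothesis controls the parent \<open>F\<close> only. The values
      at \<open>q\<close> agree because both complete the same ridge in colour
      \<open>?c\<close>.\<close>
    have "\<phi> ` F = ?g ` F" using \<phi>(2) by (intro image_cong) auto
    then have "\<phi> q = apex (C ?c) (?g ` F)" using cover_kid[OF \<phi>(1) step(1,2)] by simp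
    moreover have "?g q = apex (C ?c) (?g ` F)"
    proof (rule X.apex_unique(2)[OF c gF])
      show "?g q \<notin> ?g ` F"
        using inj_on_image_mem_iff[OF inj, of q F] kids_notin[OF step(1,2)] by blast
      show "insert (?g q) (?g ` F) \<in> C ?c" using im by (simp only: image_insert)
    qed
    ultimately have "\<forall>x\<in>insert q F. \<phi> x = ?g x" using \<phi>(2) by simp
    then have "\<forall>x\<in>B. \<phi> x = g x" using uB by (metis fun_upd_other insertI2)
    then show ?case using \<phi>(1) by blast
  qed
  then show ?thesis using that by blast
qed

lemma cover_agree:
  assumes "cover d k (arboreal d k) (tree_faces d k) X C \<phi>"
    and "cover d k (arboreal d k) (tree_faces d k) X C \<psi>"
    and "\<And>x. x \<in> base_ridge d \<Longrightarrow> \<phi> x = \<psi> x"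
    and "A \<in> arboreal d k" "x \<in> A"
  shows "\<phi> x = \<psi> x"
proof -
  have kid: "\<phi> q = \<psi> q" if "F \<in> ridges d k" "q \<in> kids d k F" "\<forall>x\<in>F. \<phi> x = \<psi> x" for F q
  proof -
    have "\<phi> ` F = \<psi> ` F" using that(3) by (intro image_cong) auto
    then show ?thesis using cover_kid[OF assms(1) that(1,2)] cover_kid[OF assms(2) that(1,2)] by simp
  qed
  have ridge: "\<forall>x\<in>F. \<phi> x = \<psi> x" if "F \<in> ridges d k" for F
    using that
  proof induction
    case (step F q B)
    then show ?case using kid[of F q] by auto
  qed (use assms(3) in auto)
  obtain F q where "F \<in> ridges d k" "q \<in> kids d k F" "A \<subseteq> insert q F"
    using assms(4) unfolding arboreal_eq by blast
  then show ?thesis using kid ridge assms(5) by blast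
qed

text \<open>A cover taking the base ridge to \<open>\<tau>\<close> and a cover taking \<open>\<tau>\<close> back compose to the identity.\<close>

lemma arboreal_homogeneous:
  assumes \<tau>: "\<tau> \<in> ridges d k"
  shows "simplicial_iso (nbhd_complex d (arboreal d k) (base_ridge d) r)
           (nbhd_complex d (arboreal d k) \<tau> r)"
proof -
  let ?T = "arboreal d k" and ?C = "tree_faces d k"
  have base: "base_ridge d \<in> ridges d k" by (rule ridges.base_ridge)
  obtain g where g: "bij_betw g \<tau> (base_ridge d)"
    using finite_same_card_bij[OF ridge_finite[OF \<tau>] finite_root] ridge_card[OF \<tau>] by auto
  obtain \<psi> where \<psi>: "cover d k ?T ?C ?T ?C \<psi>" "\<And>x. x \<in> \<tau> \<Longrightarrow> \<psi> x = g x"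
    using cover_extending[OF coloured_arboreal \<tau>, of g] g base faces_arboreal
    by (metis bij_betw_def)
  have h: "bij_betw (inv_into \<tau> g) (base_ridge d) \<tau>" using g by (rule bij_betw_inv_into)
  obtain \<phi> where \<phi>: "cover d k ?T ?C ?T ?C \<phi>" "\<And>x. x \<in> base_ridge d \<Longrightarrow> \<phi> x = inv_into \<tau> g x"
    using cover_extending[OF coloured_arboreal base, of "inv_into \<tau> g"] h \<tau> faces_arboreal
    by (metis bij_betw_def)
  interpret \<psi>: cover d k ?T ?C ?T ?C \<psi> by (rule \<psi>(1))
  interpret \<phi>: cover d k ?T ?C ?T ?C \<phi> by (rule \<phi>(1))
  have comp: "cover d k ?T ?C ?T ?C (\<psi> \<circ> \<phi>)"
  proof (intro cover.intro cover_axioms.intro coloured_arboreal)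
    fix c A assume "c \<in> {1..k}" "A \<in> ?C c"
    then show "inj_on (\<psi> \<circ> \<phi>) A \<and> (\<psi> \<circ> \<phi>) ` A \<in> ?C c"
      using \<phi>.cover_face[of c A] \<psi>.cover_face[of c "\<phi> ` A"] by (simp add: comp_inj_on image_comp)
  qed
  have id: "cover d k ?T ?C ?T ?C id"
    by (intro cover.intro cover_axioms.intro coloured_arboreal) simp
  have base_id: "(\<psi> \<circ> \<phi>) x = id x" if "x \<in> base_ridge d" for x
  proof -
    have "inv_into \<tau> g x \<in> \<tau>" using that h bij_betwE by blast
    then show ?thesis using that \<phi>(2) \<psi>(2) g by (simp add: bij_betw_inv_into_right)
  qed
  \<comment> \<open>A left inverse makes \<open>\<phi>\<close> injective on all vertices, so
    \<open>nbhd_iso\<close> applies to it for every \<open>r\<close>.\<close>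
  have "\<psi> (\<phi> x) = x" if "x \<in> A" "A \<in> ?T" for x A
    using cover_agree[OF comp id base_id that(2,1)] by simp
  then have "inj_on \<phi> (\<Union>?T)" by (metis (no_types, lifting) UnionE inj_onI)
  then have "inj_on \<phi> (\<Union>{A \<in> faces ?T (int d). \<exists>\<rho>\<in>line_ball d ?T (base_ridge d) r. \<rho> \<subseteq> A})"
    by (rule inj_on_subset) (auto simp: faces_def)
  moreover have "\<phi> ` base_ridge d = \<tau>"
    using \<phi>(2) h by (metis bij_betw_imp_surj_on image_cong)
  ultimately show ?thesis using \<phi>.nbhd_iso[of "base_ridge d" r] base faces_arboreal by simp
qed

end

section \<open>Steiner systems and switchings\<close>

lemma steiner_memD:
  assumes "S \<in> steiner_systems n d" "A \<in> S"
  shows "A \<subseteq> {1..n}" "finite A" "card A = Suc d"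
  using assms by (auto simp: steiner_systems_def intro: finite_subset)

lemma steiner_unique:
  assumes S: "S \<in> steiner_systems n d" and A: "A \<in> S" "A' \<in> S" and c: "d \<le> card (A \<inter> A')"
  shows "A = A'"
proof -
  obtain B where B: "B \<subseteq> A \<inter> A'" "card B = d" using obtain_subset_with_card_n[OF c] by blast
  then have "B \<subseteq> {1..n}" using steiner_memD[OF S A(1)] by blast
  then have "\<exists>!A. A \<in> S \<and> B \<subseteq> A" using S B(2) by (auto simp: steiner_systems_def)
  then show ?thesis using A B(1) by blast
qed

lemma steiner_insert_unique:
  assumes S: "S \<in> steiner_systems n d" and "insert a R \<in> S" "insert b R \<in> S" "a \<notin> R" "b \<notin> R"
  shows "a = b"
proof -
  have "card R = d" using steiner_memD[OF S assms(2)] assms(4) by simp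
  moreover have "card R \<le> card (insert a R \<inter> insert b R)"
    using steiner_memD[OF S assms(2)] by (intro card_mono) auto
  ultimately have "insert a R = insert b R" using steiner_unique[OF S assms(2,3)] by simp
  then show ?thesis using assms(4,5) by blast
qed

text \<open>The symmetry of Steiner systems on which the probability estimate rests.\<close>

lemma steiner_image:
  assumes S: "S \<in> steiner_systems n d" and \<pi>: "bij_betw \<pi> {1..n} {1..n}"
  shows "(`) \<pi> ` S \<in> steiner_systems n d"
  unfolding steiner_systems_def
proof (intro CollectI conjI ballI allI impI)
  have inj: "inj_on \<pi> {1..n}" and im: "\<pi> ` {1..n} = {1..n}" using \<pi> by (auto simp: bij_betw_def)
  fix A' assume "A' \<in> (`) \<pi> ` S"
  then obtain A where A: "A \<in> S" "A' = \<pi> ` A" by blast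
  note m = steiner_memD[OF S A(1)]
  show "A' \<subseteq> {1..n}" "card A' = d + 1"
    using A(2) m im inj_on_subset[OF inj m(1)] by (auto simp: card_image)
next
  have inj: "inj_on \<pi> {1..n}" and im: "\<pi> ` {1..n} = {1..n}" using \<pi> by (auto simp: bij_betw_def)
  fix B' assume B': "B' \<subseteq> {1..n} \<and> card B' = d"
  then obtain B where B: "B \<subseteq> {1..n}" "B' = \<pi> ` B" using im by (metis subset_imageE)
  then have "card B = d" using B' inj_on_subset[OF inj B(1)] by (simp add: card_image)
  then have ex1: "\<exists>!A. A \<in> S \<and> B \<subseteq> A" using S B(1) by (auto simp: steiner_systems_def)
  have sub: "\<pi> ` B \<subseteq> \<pi> ` A \<longleftrightarrow> B \<subseteq> A" if "A \<in> S" for A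
    using inj_on_image_subset_iff[OF inj B(1) steiner_memD(1)[OF S that]] .
  show "\<exists>!A'. A' \<in> (`) \<pi> ` S \<and> B' \<subseteq> A'"
  proof -
    obtain A where A: "A \<in> S" "B \<subseteq> A" using ex1 by blast
    show ?thesis
    proof (intro ex1I[of _ "\<pi> ` A"] conjI)
      show "\<pi> ` A \<in> (`) \<pi> ` S" "B' \<subseteq> \<pi> ` A" using A B(2) by auto
      fix A' assume "A' \<in> (`) \<pi> ` S \<and> B' \<subseteq> A'"
      then obtain A'' where "A'' \<in> S" "A' = \<pi> ` A''" "B \<subseteq> A''" using sub B(2) by blast
      then show "A' = \<pi> ` A" using ex1 A by blast
    qed
  qed
qed

lemma finite_steiner_systems: "finite (steiner_systems n d)"
  by (rule finite_subset[of _ "Pow (Pow {1..n})"]) (auto simp: steiner_systems_def)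

section \<open>Tuples of Steiner systems, and vertex sets closed under parents\<close>

definition steiner_complex :: "nat \<Rightarrow> nat \<Rightarrow> nat \<Rightarrow> (nat \<Rightarrow> nat set set) \<Rightarrow> nat set set" where
  "steiner_complex d k n S = {A. A \<subseteq> {1..n} \<and> card A \<le> d} \<union> (\<Union>j\<in>{1..k}. S j)"

definition steiner_tuples :: "nat \<Rightarrow> nat \<Rightarrow> nat \<Rightarrow> (nat \<Rightarrow> nat set set) set" where
  "steiner_tuples d k n = PiE {1..k} (\<lambda>_. steiner_systems n d)"

lemma finite_steiner_tuples: "finite (steiner_tuples d k n)"
  unfolding steiner_tuples_def by (intro finite_PiE finite_steiner_systems) auto

lemma steiner_tuplesD: "S \<in> steiner_tuples d k n \<Longrightarrow> j \<in> {1..k} \<Longrightarrow> S j \<in> steiner_systems n d"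
  by (auto simp: steiner_tuples_def)

text \<open>The vertex sets on which the recursion of \<open>cover_map\<close> runs without leaving
  the set.\<close>

definition ancestral :: "nat \<Rightarrow> nat \<Rightarrow> tree_vertex set \<Rightarrow> bool" where
  "ancestral d k D \<longleftrightarrow> base_ridge d \<subseteq> D \<and>
     (\<forall>x\<in>D - base_ridge d. par d x \<in> ridges d k \<and> x \<in> kids d k (par d x) \<and> par d x \<subseteq> D)"

text \<open>Vertices of the same rank as \<open>q\<close> count as older: their parents have smaller
  rank, so their values do not depend on that of \<open>q\<close>.\<close>

definition older :: "tree_vertex set \<Rightarrow> tree_vertex \<Rightarrow> tree_vertex set" where
  "older D q = {x \<in> D. rk x \<le> rk q} - {q}"

context arboreal_params
begin

text \<open>Makes every attached vertex have rank at least \<open>d\<close>, above all ranks in the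
  base ridge.\<close>

lemma ridge_rk: "B \<in> ridges d k \<Longrightarrow> \<exists>x\<in>B. d - 1 \<le> rk x"
proof (induction rule: ridges.induct)
  case base_ridge
  have "Base (d - 1) \<in> base_ridge d" using d_pos by (simp add: base_ridge_def)
  then show ?case by force
next
  case (step F q B)
  then show ?case using rk_kids[of F q] by (meson less_imp_le order_trans)
qed

lemma rk_kid_ge: "F \<in> ridges d k \<Longrightarrow> q \<in> kids d k F \<Longrightarrow> d \<le> rk q"
  using ridge_rk[of F] rk_kids[of F q] by fastforce

lemma rk_base: "x \<in> base_ridge d \<Longrightarrow> rk x < d"
  by (auto simp: base_ridge_def)

lemma ancestralD:
  assumes "ancestral d k D" "x \<in> D" "x \<notin> base_ridge d"
  shows "par d x \<in> ridges d k" "x \<in> kids d k (par d x)" "par d x \<subseteq> D" "d \<le> rk x"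
    "y \<in> par d x \<Longrightarrow> rk y < rk x" "col x \<in> {1..k}"
  using assms rk_kid_ge rk_kids col_range unfolding ancestral_def by blast+

lemma ancestral_older:
  assumes D: "ancestral d k D" and q: "q \<in> D" "q \<notin> base_ridge d"
  shows "ancestral d k (older D q)" "par d q \<subseteq> older D q"
proof -
  have "par d x \<subseteq> older D q" if x: "x \<in> D" "x \<notin> base_ridge d" "rk x \<le> rk q" for x
    using ancestralD(3,5)[OF D x(1,2)] x(3) unfolding older_def by fastforce
  moreover have "base_ridge d \<subseteq> older D q"
    using D q rk_base ancestralD(4)[OF D q] unfolding older_def ancestral_def by fastforce
  ultimately show "ancestral d k (older D q)" "par d q \<subseteq> older D q"
    using D q unfolding ancestral_def older_def by auto
qed

lemma ancestral_Un: "ancestral d k D \<Longrightarrow> ancestral d k D' \<Longrightarrow> ancestral d k (D \<union> D')"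
  unfolding ancestral_def by blast

text \<open>A parent has smaller rank than its kid, so a vertex \<open>t\<close> of maximal rank
  lies in no parent.\<close>

lemma ancestral_remove:
  assumes "ancestral d k D" "t \<in> D" "t \<notin> base_ridge d" "\<And>x. x \<in> D - base_ridge d \<Longrightarrow> rk x \<le> rk t"
  shows "ancestral d k (D - {t})"
  using assms(1,3) ancestralD(5)[OF assms(1)] assms(4) unfolding ancestral_def
  by (metis Diff_iff Diff_insert_absorb insert_Diff_single leD subset_insert_iff)

lemma ancestral_insert_kid:
  "ancestral d k D \<Longrightarrow> F \<in> ridges d k \<Longrightarrow> F \<subseteq> D \<Longrightarrow> q \<in> kids d k F \<Longrightarrow> ancestral d k (insert q D)"
  unfolding ancestral_def using par_kids by auto

lemma ridge_ancestral:
  assumes "F \<in> ridges d k"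
  obtains D where "finite D" "ancestral d k D" "F \<subseteq> D"
proof -
  have "\<exists>D. finite D \<and> ancestral d k D \<and> F \<subseteq> D"
    using assms
  proof induction
    case base_ridge
    have "ancestral d k (base_ridge d)" by (simp add: ancestral_def)
    then show ?case using finite_root by blast
  next
    case (step F q B)
    then obtain D where "finite D" "ancestral d k D" "F \<subseteq> D" by blast
    then show ?case
      using ancestral_insert_kid[of D F q] step(1-3)
      by (intro exI[of _ "insert q D"]) auto
  qed
  with that show ?thesis by blast
qed

lemma faces_ancestral:
  assumes "finite \<A>" "\<A> \<subseteq> arboreal d k"
  obtains D where "finite D" "ancestral d k D" "\<Union>\<A> \<subseteq> D"
proof -
  have "\<exists>D. finite D \<and> ancestral d k D \<and> \<Union>\<A> \<subseteq> D"
    using assms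
  proof induction
    case empty
    obtain D where "finite D" "ancestral d k D" using ridge_ancestral[OF ridges.base_ridge] .
    then show ?case by auto
  next
    case (insert A \<A>)
    then obtain D where D: "finite D" "ancestral d k D" "\<Union>\<A> \<subseteq> D" by auto
    obtain F q where F: "F \<in> ridges d k" "q \<in> kids d k F" "A \<subseteq> insert q F"
      using insert.prems unfolding arboreal_eq by blast
    obtain D' where D': "finite D'" "ancestral d k D'" "F \<subseteq> D'" using ridge_ancestral[OF F(1)] .
    have "ancestral d k (D \<union> insert q D')"
      using ancestral_Un[OF D(2) ancestral_insert_kid[OF D'(2) F(1) D'(3) F(2)]] .
    then show ?case
      using D D' F(3) by (intro exI[of _ "D \<union> insert q D'"]) auto
  qed
  with that show ?thesis by blast
qed

end

section \<open>The cover of a Steiner complex and its switchings\<close>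

locale steiner_cover = arboreal_params +
  fixes n :: nat and e :: "nat \<Rightarrow> nat"
  assumes e_inj: "inj_on e {..<d}" and e_range: "e ` {..<d} \<subseteq> {1..n}"
begin

abbreviation tuples where "tuples \<equiv> steiner_tuples d k n"

abbreviation \<phi> where "\<phi> S \<equiv> cover_map d S e"

lemma coloured_steiner:
  assumes "S \<in> tuples"
  shows "coloured_complex d k (steiner_complex d k n S) S"
    "faces (steiner_complex d k n S) (int d - 1) = {B. B \<subseteq> {1..n} \<and> card B = d}"
proof -
  note mem = steiner_memD[OF steiner_tuplesD[OF assms]]
  let ?X = "steiner_complex d k n S"
  show ridges: "faces ?X (int d - 1) = {B. B \<subseteq> {1..n} \<and> card B = d}"
  proof (intro set_eqI iffI)
    fix B assume "B \<in> faces ?X (int d - 1)"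
    then have "B \<in> ?X" "card B = d" by (auto simp: faces_def)
    then show "B \<in> {B. B \<subseteq> {1..n} \<and> card B = d}"
      using mem(1)[of _ B] unfolding steiner_complex_def by blast
  next
    fix B assume "B \<in> {B. B \<subseteq> {1..n} \<and> card B = d}"
    then show "B \<in> faces ?X (int d - 1)"
      using finite_subset[of B "{1..n}"] by (simp add: steiner_complex_def faces_def)
  qed
  show "coloured_complex d k ?X S"
  proof
    fix A B assume A: "A \<in> ?X" "B \<subseteq> A"
    have fin: "finite A" "A \<subseteq> {1..n}" using A(1) mem finite_subset unfolding steiner_complex_def by blast+
    show "B \<in> ?X"
    proof (cases "B = A")
      case False
      have "card A \<le> Suc d" using A(1) mem unfolding steiner_complex_def by fastforce
      moreover have "card B < card A" using A(2) False fin(1) by (metis psubsetI psubset_card_mono)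
      ultimately show ?thesis using A(2) fin(2) unfolding steiner_complex_def by auto
    qed (use A in simp)
  next
    show "A \<in> ?X \<Longrightarrow> finite A" for A using mem finite_subset unfolding steiner_complex_def by blast
  next
    show "faces ?X (int d) = (\<Union>c\<in>{1..k}. S c)"
      unfolding steiner_complex_def faces_def using mem by auto
  next
    fix c B assume c: "c \<in> {1..k}" and "B \<in> faces ?X (int d - 1)"
    then have "B \<subseteq> {1..n}" "card B = d" unfolding ridges by auto
    then show "\<exists>!A. A \<in> S c \<and> B \<subseteq> A"
      using steiner_tuplesD[OF assms c] by (auto simp: steiner_systems_def)
  qed (use d_pos k_pos in auto)
qed

lemma cover_steiner:
  assumes "S \<in> tuples"
  shows "cover d k (arboreal d k) (tree_faces d k) (steiner_complex d k n S) S (\<phi> S)"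
  using cover_map_cover[OF coloured_steiner(1)[OF assms] e_inj] coloured_steiner(2)[OF assms]
    e_inj e_range by (simp add: card_image)

lemma phi_ridge_kid:
  assumes S: "S \<in> tuples" and F: "F \<in> ridges d k" "q \<in> kids d k F"
  shows "\<phi> S q \<notin> \<phi> S ` F" "insert (\<phi> S q) (\<phi> S ` F) \<in> S (col q)" "inj_on (\<phi> S) F"
proof -
  interpret cover d k "arboreal d k" "tree_faces d k" "steiner_complex d k n S" S "\<phi> S"
    by (rule cover_steiner[OF S])
  have *: "inj_on (\<phi> S) (insert q F)" "\<phi> S ` insert q F \<in> S (col q)"
    using cover_face[OF col_range[OF F] kid_face[OF F]] by auto
  show "insert (\<phi> S q) (\<phi> S ` F) \<in> S (col q)" using *(2) by simp
  show "inj_on (\<phi> S) F" using *(1) by simp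
  show "\<phi> S q \<notin> \<phi> S ` F" using *(1) kids_notin[OF F] by simp
qed

lemma phi_kid:
  assumes "S \<in> tuples" "ancestral d k D" "x \<in> D" "x \<notin> base_ridge d"
  shows "\<phi> S x \<notin> \<phi> S ` par d x" "insert (\<phi> S x) (\<phi> S ` par d x) \<in> S (col x)"
  using phi_ridge_kid[OF assms(1) ancestralD(1,2)[OF assms(2-4)]] by auto

lemma phi_range:
  assumes S: "S \<in> tuples" and D: "ancestral d k D" "x \<in> D"
  shows "\<phi> S x \<in> {1..n}"
proof (cases "x \<in> base_ridge d")
  case True
  then show ?thesis using cover_map_base_ridge[of d S e] e_range by blast
next
  case False
  have "S (col x) \<in> steiner_systems n d"
    by (rule steiner_tuplesD[OF S ancestralD(6)[OF D False]])
  then show ?thesis using steiner_memD(1)[OF _ phi_kid(2)[OF S D False]] by blast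
qed

lemma phi_base: "x \<in> base_ridge d \<Longrightarrow> \<phi> S x = \<phi> S' x"
  by (auto simp: base_ridge_def)

definition switch :: "nat \<Rightarrow> nat \<Rightarrow> nat \<Rightarrow> (nat \<Rightarrow> nat set set) \<Rightarrow> nat \<Rightarrow> nat set set" where
  "switch c y x S = S(c := (`) (Transposition.transpose y x) ` S c)"

lemma switch_tuples:
  assumes "S \<in> tuples" "c \<in> {1..k}" "y \<in> {1..n}" "x \<in> {1..n}"
  shows "switch c y x S \<in> tuples"
proof -
  have "bij_betw (Transposition.transpose y x) {1..n} {1..n}"
    using assms(3,4) by (simp add: bij_betw_transpose_iff)
  then have "(`) (Transposition.transpose y x) ` S c \<in> steiner_systems n d"
    by (rule steiner_image[OF steiner_tuplesD[OF assms(1,2)]])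
  then show ?thesis using assms(1,2) unfolding switch_def steiner_tuples_def by (auto simp: PiE_iff extensional_def)
qed

text \<open>Neither transposed point is a value at a vertex older than \<open>q\<close>. So blocks
  spanned by older values are fixed, and the older values persist by induction on the rank. The
  block above the parent of \<open>q\<close> is carried to one with \<open>x\<close> in place of
  \<open>\<phi> S q\<close>.\<close>

lemma phi_switch:
  assumes S: "S \<in> tuples" and D: "ancestral d k D" and q: "q \<in> D" "q \<notin> base_ridge d"
    and y: "\<phi> S q \<notin> \<phi> S ` older D q" and x: "x \<in> {1..n}" "x \<notin> \<phi> S ` older D q"
  shows "switch (col q) (\<phi> S q) x S \<in> tuples"
    and "v \<in> older D q \<Longrightarrow> \<phi> (switch (col q) (\<phi> S q) x S) v = \<phi> S v"
    and "\<phi> (switch (col q) (\<phi> S q) x S) q = x"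
proof -
  let ?\<pi> = "Transposition.transpose (\<phi> S q) x" and ?S = "switch (col q) (\<phi> S q) x S"
  show S': "?S \<in> tuples"
    using switch_tuples[OF S ancestralD(6)[OF D q] phi_range[OF S D q(1)] x(1)] .
  have fix_image: "?\<pi> ` \<phi> S ` B = \<phi> S ` B" if "B \<subseteq> older D q" for B
  proof -
    have "?\<pi> (\<phi> S b) = \<phi> S b" if "b \<in> B" for b
    proof -
      have "\<phi> S b \<in> \<phi> S ` older D q" using that \<open>B \<subseteq> older D q\<close> by blast
      then show ?thesis using x(2) y by (metis transpose_apply_other)
    qed
    then show ?thesis by (simp add: image_image)
  qed
  note O = ancestral_older[OF D q]
  have older: "\<phi> ?S v = \<phi> S v" if "v \<in> older D q" for v
    using that
  proof (induction "rk v" arbitrary: v rule: less_induct)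
    case less
    show ?case
    proof (cases "v \<in> base_ridge d")
      case True
      then show ?thesis by (rule phi_base)
    next
      case False
      note v = ancestralD[OF O(1) less.prems False]
      have par: "\<phi> ?S ` par d v = \<phi> S ` par d v"
        using less.hyps v(3,5) by (intro image_cong) auto
      have "insert (\<phi> S v) (\<phi> S ` par d v) \<in> ?S (col v)"
      proof (cases "col v = col q")
        case True
        have "?\<pi> ` \<phi> S ` insert v (par d v) = \<phi> S ` insert v (par d v)"
          using v(3) less.prems by (intro fix_image) auto
        moreover have "\<phi> S ` insert v (par d v) \<in> S (col q)"
          using phi_kid(2)[OF S O(1) less.prems False] True by simp
        ultimately have "\<phi> S ` insert v (par d v) \<in> (`) ?\<pi> ` S (col q)" by (metis imageI)
        then show ?thesis using True by (simp add: switch_def)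
      next
        case False
        then show ?thesis
          using phi_kid(2)[OF S O(1) less.prems \<open>v \<notin> base_ridge d\<close>] by (simp add: switch_def)
      qed
      then show ?thesis
        using steiner_insert_unique[OF steiner_tuplesD[OF S' v(6)]]
          phi_kid(1,2)[OF S' O(1) less.prems False] phi_kid(1)[OF S O(1) less.prems False]
        unfolding par by metis
    qed
  qed
  then show "v \<in> older D q \<Longrightarrow> \<phi> ?S v = \<phi> S v" .
  have par: "\<phi> ?S ` par d q = \<phi> S ` par d q" using older O(2) by (intro image_cong) auto
  have "?\<pi> ` insert (\<phi> S q) (\<phi> S ` par d q) = insert x (\<phi> S ` par d q)"
    using fix_image[OF O(2)] by simp
  then have "insert x (\<phi> S ` par d q) \<in> ?S (col q)"
    using phi_kid(2)[OF S D q] unfolding switch_def by (metis fun_upd_same imageI)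
  moreover have "x \<notin> \<phi> S ` par d q" using x(2) O(2) by blast
  ultimately show "\<phi> ?S q = x"
    using steiner_insert_unique[OF steiner_tuplesD[OF S' ancestralD(6)[OF D q]]]
      phi_kid(1,2)[OF S' D q] unfolding par by metis
qed

text \<open>Double counting: switching the colour of \<open>q\<close> lets \<open>\<phi> S q\<close> range over all values not yet
  used, without affecting the other colours and the older vertices. If these determine
  \<open>\<phi> S q\<close> within \<open>E\<close>, then the switchings of members of \<open>E\<close> are pairwise distinct.\<close>

lemma switching_bound:
  assumes D: "finite D" "ancestral d k D" and q: "q \<in> D" "q \<notin> base_ridge d"
    and E: "E \<subseteq> tuples" "\<And>S. S \<in> E \<Longrightarrow> \<phi> S q \<notin> \<phi> S ` older D q"
    and det: "\<And>S S'. S \<in> E \<Longrightarrow> S' \<in> E \<Longrightarrow> (\<And>c. c \<noteq> col q \<Longrightarrow> S c = S' c) \<Longrightarrow>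
      (\<And>v. v \<in> older D q \<Longrightarrow> \<phi> S v = \<phi> S' v) \<Longrightarrow> \<phi> S q = \<phi> S' q"
  shows "card E * (n - card D) \<le> card tuples"
proof -
  let ?U = "\<lambda>S. {1..n} - \<phi> S ` older D q"
  let ?f = "\<lambda>(S, x). switch (col q) (\<phi> S q) x S"
  have finE: "finite E" using E(1) finite_steiner_tuples by (rule finite_subset)
  note sw = phi_switch[OF _ D(2) q]
  have inj: "inj_on ?f (Sigma E ?U)"
  proof (rule inj_onI, clarify)
    fix S x S' x'
    assume S: "S \<in> E" "S' \<in> E" and x: "x \<in> {1..n}" "x \<notin> \<phi> S ` older D q"
      "x' \<in> {1..n}" "x' \<notin> \<phi> S' ` older D q"
      and eq: "switch (col q) (\<phi> S q) x S = switch (col q) (\<phi> S' q) x' S'"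
    note s = sw[of S, OF _ E(2)[OF S(1)] x(1,2)] and s' = sw[of S', OF _ E(2)[OF S(2)] x(3,4)]
    have SS: "S \<in> tuples" "S' \<in> tuples" using S E(1) by auto
    have xx: "x = x'" using s(3) s'(3) SS eq by simp
    have 1: "S c = S' c" if "c \<noteq> col q" for c
      using fun_cong[OF eq, of c] that by (simp add: switch_def)
    have 2: "\<phi> S v = \<phi> S' v" if "v \<in> older D q" for v
      using s(2)[OF SS(1) that] s'(2)[OF SS(2) that] eq by simp
    \<comment> \<open>The other colours and the older values survive the switch and can be read off
      its result. By \<open>det\<close> they yield \<open>\<phi> S q\<close>, hence the
      transposition, which is its own inverse.\<close>
    have yy: "\<phi> S q = \<phi> S' q" using det[OF S 1 2] .
    have "S (col q) = S' (col q)"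
    proof -
      let ?\<pi> = "Transposition.transpose (\<phi> S q) x"
      have "(`) ?\<pi> ` S (col q) = (`) ?\<pi> ` S' (col q)"
        using fun_cong[OF eq, of "col q"] xx yy by (simp add: switch_def)
      then have "(`) ?\<pi> ` (`) ?\<pi> ` S (col q) = (`) ?\<pi> ` (`) ?\<pi> ` S' (col q)" by simp
      then show ?thesis by (simp add: image_image)
    qed
    with 1 have "S = S'" by (metis ext)
    with xx show "S = S' \<and> x = x'" by simp
  qed
  \<comment> \<open>At most \<open>card D\<close> points are in use; all others may serve as
    \<open>x\<close>.\<close>
  have "n - card D \<le> card (?U S)" for S
  proof -
    have "card (\<phi> S ` older D q) \<le> card D"
      using D(1) by (intro order_trans[OF card_image_le card_mono]) (auto simp: older_def)
    moreover have "card {1..n} - card (\<phi> S ` older D q) \<le> card (?U S)"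
      using D(1) by (intro diff_card_le_card_Diff) (simp add: older_def)
    ultimately show ?thesis by simp
  qed
  then have "card E * (n - card D) \<le> (\<Sum>S\<in>E. card (?U S))"
    using sum_mono[of E "\<lambda>_. n - card D" "\<lambda>S. card (?U S)"] by simp
  also have "\<dots> = card (Sigma E ?U)" using finE by (simp add: card_SigmaI)
  also have "\<dots> \<le> card tuples"
    using E sw(1) finite_steiner_tuples by (intro card_inj_on_le[OF inj]) auto
  finally show ?thesis .
qed

end

section \<open>Collisions between values of the cover\<close>

context steiner_cover
begin

text \<open>The bound \<open>d - 1\<close> is the rank of \<open>Base (d - 1)\<close>, the newest
  vertex of the base ridge. Any other ridge has an attached newest vertex, which can be switched;
  rank comparisons tell the two cases apart.\<close>

lemma ridge_newest_cases:
  assumes "B \<in> ridges d k" "newest B = {p}"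
  shows "p \<in> B" "\<And>x. x \<in> B \<Longrightarrow> x \<noteq> p \<Longrightarrow> rk x < rk p" "d - 1 \<le> rk p"
    and "B = base_ridge d \<and> p = Base (d - 1) \<or>
      B \<noteq> base_ridge d \<and> p \<notin> base_ridge d \<and> par d p \<in> ridges d k \<and> p \<in> kids d k (par d p) \<and>
      B \<subseteq> insert p (par d p)"
proof -
  obtain q where q: "newest B = {q}" "q \<in> B" "\<And>x. x \<in> B \<Longrightarrow> x \<noteq> q \<Longrightarrow> rk x < rk q"
    using newest_ridge[OF assms(1)] by blast
  then have pq: "p = q" using assms(2) by simp
  show "p \<in> B" "\<And>x. x \<in> B \<Longrightarrow> x \<noteq> p \<Longrightarrow> rk x < rk p" using q pq by auto
  obtain x where x: "x \<in> B" "d - 1 \<le> rk x" using ridge_rk[OF assms(1)] by blast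
  then show "d - 1 \<le> rk p" using q(3)[of x] pq by (cases "x = q") auto
  show "B = base_ridge d \<and> p = Base (d - 1) \<or>
      B \<noteq> base_ridge d \<and> p \<notin> base_ridge d \<and> par d p \<in> ridges d k \<and> p \<in> kids d k (par d p) \<and>
      B \<subseteq> insert p (par d p)"
  proof (cases "B = base_ridge d")
    case True
    then show ?thesis using newest_root assms(2) by simp
  next
    case False
    with assms(1) obtain q' where "par d q' \<in> ridges d k" "q' \<in> kids d k (par d q')"
      "newest B = {q'}" "B \<subseteq> insert q' (par d q')"
      by (rule ridge_cases)
    then show ?thesis using False assms(2) kids_notin_root by auto
  qed
qed

text \<open>The face \<open>insert y F\<close> has a colour other than that of \<open>q\<close>, so
  its system is common to \<open>S\<close> and \<open>S'\<close>. There the value at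
  \<open>q\<close> completes the \<open>d\<close> known values at \<open>y\<close> and at the rest
  of \<open>F\<close>. The base ridge is excluded because its kid \<open>Base d\<close> shares the
  colour of its newest vertex.\<close>

lemma newest_determined:
  assumes S: "S \<in> tuples" "S' \<in> tuples" and F: "F \<in> ridges d k" "F \<noteq> base_ridge d" "F \<subseteq> D"
    and q: "newest F = {q}" and y: "y \<in> kids d k F"
    and agree: "\<And>c. c \<noteq> col q \<Longrightarrow> S c = S' c" "\<And>v. v \<in> older D q \<Longrightarrow> \<phi> S v = \<phi> S' v"
    and eq: "\<phi> S y = \<phi> S' y"
  shows "\<phi> S q = \<phi> S' q"
proof -
  note nq = ridge_newest_cases[OF F(1) q]
  have "col y \<noteq> col q" using col_kids_neq[OF F(1,2) y] pcol_newest[OF q] by simp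
  then have col: "S (col y) = S' (col y)" by (rule agree(1))
  have "F - {q} \<subseteq> older D q" using nq(2) F(3) by (force simp: older_def)
  then have img: "\<phi> S ` (F - {q}) = \<phi> S' ` (F - {q})" using agree(2) by (intro image_cong) auto
  define R where "R = insert (\<phi> S y) (\<phi> S ` (F - {q}))"
  have *: "\<phi> U q \<notin> insert (\<phi> U y) (\<phi> U ` (F - {q}))
      \<and> insert (\<phi> U q) (insert (\<phi> U y) (\<phi> U ` (F - {q}))) \<in> U (col y)" if "U \<in> tuples" for U
  proof -
    note p = phi_ridge_kid[OF that F(1) y]
    have "\<phi> U ` F = insert (\<phi> U q) (\<phi> U ` (F - {q}))" using nq(1) by blast
    moreover have "\<phi> U q \<notin> \<phi> U ` (F - {q})"
      using p(3) nq(1) by (meson Diff_iff Diff_subset inj_on_image_mem_iff insertI1)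
    ultimately show ?thesis using p(1,2) by (auto simp: insert_commute)
  qed
  have "\<phi> S q \<notin> R" "insert (\<phi> S q) R \<in> S (col y)" using *[OF S(1)] by (auto simp: R_def)
  moreover have "\<phi> S' q \<notin> R" "insert (\<phi> S' q) R \<in> S (col y)"
    using *[OF S(2)] unfolding R_def eq img col by auto
  ultimately show ?thesis
    using steiner_insert_unique[OF steiner_tuplesD[OF S(1) col_range[OF F(1) y]]] by blast
qed

text \<open>If \<open>s\<close> is older than the newest vertex \<open>p\<close> of the parent of \<open>t\<close>, then \<open>\<phi> S t = \<phi> S s\<close>
  pins down \<open>\<phi> S p\<close>. Otherwise it pins down \<open>\<phi> S s\<close>, unless \<open>s\<close> and \<open>t\<close> have the same
  colour, when it pins down the newest vertex of their two parents.\<close>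

lemma collision_bound:
  assumes D: "finite D" "ancestral d k D" and s: "s \<in> D" and t: "t \<notin> D"
    "par d t \<in> ridges d k" "t \<in> kids d k (par d t)" "par d t \<subseteq> D"
  shows "card {S \<in> tuples. inj_on (\<phi> S) D \<and> \<phi> S t = \<phi> S s} * (n - card D) \<le> card tuples"
    (is "card ?E * _ \<le> _")
proof -
  have bound: ?thesis if q: "q \<in> D" "q \<notin> base_ridge d"
    and det: "\<And>S S'. S \<in> ?E \<Longrightarrow> S' \<in> ?E \<Longrightarrow> (\<And>c. c \<noteq> col q \<Longrightarrow> S c = S' c) \<Longrightarrow>
      (\<And>v. v \<in> older D q \<Longrightarrow> \<phi> S v = \<phi> S' v) \<Longrightarrow> \<phi> S q = \<phi> S' q" for q
  proof (rule switching_bound[OF D q _ _ det])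
    fix S assume "S \<in> ?E"
    then show "\<phi> S q \<notin> \<phi> S ` older D q"
      using q(1) inj_on_image_mem_iff[of "\<phi> S" D q "older D q"] by (auto simp: older_def)
  qed auto
  have empty: ?thesis if "?E = {}" unfolding that by simp
  note kt = phi_ridge_kid[OF _ t(2,3)]
  obtain p where p: "newest (par d t) = {p}" using newest_ridge[OF t(2)] by metis
  note np = ridge_newest_cases[OF t(2) p]
  have pD: "p \<in> D" using np(1) t(4) by blast
  consider "s \<in> par d t" | "s \<notin> par d t" "rk s \<le> rk p" | "rk s > rk p" "col s \<noteq> col t"
    | "rk s > rk p" "col s = col t" by linarith
  then show ?thesis
  proof cases
    case 1
    \<comment> \<open>A cover is injective on the face \<open>insert t (par d t)\<close>.\<close>
    then have "?E = {}" using kt(1) by auto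
    then show ?thesis by (rule empty)
  next
    case 2
    \<comment> \<open>Otherwise \<open>p\<close> would have rank \<open>d - 1\<close>, whereas
      \<open>s\<close>, lying outside the base ridge, has rank at least \<open>d\<close>.\<close>
    have ne: "par d t \<noteq> base_ridge d"
    proof
      assume b: "par d t = base_ridge d"
      then have "s \<notin> base_ridge d" using 2 by simp
      then have "d \<le> rk s" using ancestralD(4)[OF D(2) s] by simp
      moreover have "rk p = d - 1" using np(4) b by auto
      ultimately show False using 2(2) d_pos by simp
    qed
    have sO: "s \<in> older D p" using 2 s np(1) by (auto simp: older_def)
    show ?thesis
    proof (rule bound[OF pD])
      show "p \<notin> base_ridge d" using np(4) ne by blast
      fix S S' assume *: "S \<in> ?E" "S' \<in> ?E" "\<And>c. c \<noteq> col p \<Longrightarrow> S c = S' c"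
        "\<And>v. v \<in> older D p \<Longrightarrow> \<phi> S v = \<phi> S' v"
      \<comment> \<open>The value at \<open>t\<close> is that at \<open>s\<close>, which is older
        than \<open>p\<close>; the face above \<open>par d t\<close> then yields the value at
        \<open>p\<close>.\<close>
      show "\<phi> S p = \<phi> S' p"
        using *(1,2) *(4)[OF sO]
        by (intro newest_determined[OF _ _ t(2) ne t(4) p t(3) *(3,4)]) auto
    qed
  next
    case 3
    then have sb: "s \<notin> base_ridge d" using rk_base[of s] np(3) by fastforce
    \<comment> \<open>The parent of \<open>t\<close> precedes \<open>s\<close> and the system of
      colour \<open>col t\<close> is kept, so the value at \<open>t\<close> is determined, and by
      the collision that at \<open>s\<close>.\<close>
    have "par d t \<subseteq> older D s"
    proof
      fix x assume "x \<in> par d t"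
      then show "x \<in> older D s"
        using np(2)[of x] 3(1) t(4) by (cases "x = p") (auto simp: older_def)
    qed
    then show ?thesis
    proof (intro bound[OF s sb])
      fix S S' assume *: "S \<in> ?E" "S' \<in> ?E" "\<And>c. c \<noteq> col s \<Longrightarrow> S c = S' c"
        "\<And>v. v \<in> older D s \<Longrightarrow> \<phi> S v = \<phi> S' v" and sub: "par d t \<subseteq> older D s"
      have "\<phi> S ` par d t = \<phi> S' ` par d t" using *(4) sub by (intro image_cong) auto
      then have "\<phi> S t = \<phi> S' t"
        using cover_map_kid[OF t(2,3), of S e] cover_map_kid[OF t(2,3), of S' e] *(3)[of "col t"] 3(2)
        by simp
      then show "\<phi> S s = \<phi> S' s" using *(1,2) by simp
    qed
  next
    case 4
    then have sb: "s \<notin> base_ridge d" using rk_base[of s] np(3) by fastforce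
    note ps = ancestralD[OF D(2) s sb]
    obtain q where q: "newest (par d s) = {q}" using newest_ridge[OF ps(1)] by metis
    note nq = ridge_newest_cases[OF ps(1) q]
    have qD: "q \<in> D" using nq(1) ps(3) by blast
    have ne: "par d s \<noteq> par d t"
    proof
      assume "par d s = par d t"
      then have "s = t" using col_kids_inj[OF t(2) _ t(3) 4(2)] ps(2) by simp
      then show False using s t(1) by simp
    qed
    \<comment> \<open>Serves both orders of the two newest vertices. The parent of \<open>x\<close>
      precedes \<open>q'\<close>, and \<open>x\<close> has a colour other than that of
      \<open>q'\<close>, so its value is determined. The collision passes it to \<open>y\<close>,
      and \<open>newest_determined\<close> passes it on to \<open>q'\<close>.\<close>
    have later: "\<phi> S q' = \<phi> S' q'"
      if x: "par d x \<in> ridges d k" "x \<in> kids d k (par d x)" "par d x \<subseteq> D" "newest (par d x) = {p'}"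
        and y: "par d y \<in> ridges d k" "y \<in> kids d k (par d y)" "par d y \<subseteq> D" "newest (par d y) = {q'}"
        and xy: "col x = col y" "p' \<noteq> q'" "rk p' \<le> rk q'" "par d y \<noteq> base_ridge d"
        and SS: "S \<in> tuples" "S' \<in> tuples" "\<phi> S x = \<phi> S y" "\<phi> S' x = \<phi> S' y"
        and agree: "\<And>c. c \<noteq> col q' \<Longrightarrow> S c = S' c" "\<And>v. v \<in> older D q' \<Longrightarrow> \<phi> S v = \<phi> S' v"
      for x y p' q' S S'
    proof (rule newest_determined[OF SS(1,2) y(1) xy(4) y(3,4,2) agree])
      note nx = ridge_newest_cases[OF x(1,4)]
      have "par d x \<subseteq> older D q'"
      proof
        fix v assume v: "v \<in> par d x"
        then have "rk v \<le> rk q'" "v \<noteq> q'"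
          using nx(2)[of v] xy(2,3) by (cases "v = p'"; force)+
        then show "v \<in> older D q'" using v x(3) by (auto simp: older_def)
      qed
      then have "\<phi> S ` par d x = \<phi> S' ` par d x" using agree(2) by (intro image_cong) auto
      moreover have "col x \<noteq> col q'" using col_kids_neq[OF y(1) xy(4) y(2)] pcol_newest[OF y(4)] xy(1) by simp
      ultimately have "\<phi> S x = \<phi> S' x"
        using cover_map_kid[OF x(1,2), of S e] cover_map_kid[OF x(1,2), of S' e] agree(1)[of "col x"]
        by simp
      then show "\<phi> S y = \<phi> S' y" using SS(3,4) by simp
    qed
    consider "p = q" | "p \<noteq> q" "rk p \<le> rk q" | "p \<noteq> q" "rk q < rk p" by linarith
    then show ?thesis
    proof cases
      case 1
      then have pb: "p \<notin> base_ridge d" "par d t \<subseteq> insert p (par d p)" "par d s \<subseteq> insert p (par d p)"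
        "par d p \<in> ridges d k"
        using np nq ne by (auto simp: base_ridge_def)
      \<comment> \<open>Both parents lie in the face created with \<open>p\<close>, so they share at
        least \<open>d - 1\<close> vertices. With the common value at \<open>s\<close> and
        \<open>t\<close>, the two blocks of one colour share \<open>d\<close> points and coincide.
        Then the parents have equal images, against injectivity on \<open>D\<close>.\<close>
      have "?E = {}"
      proof (rule ccontr)
        assume "?E \<noteq> {}"
        then obtain S where S: "S \<in> tuples" "inj_on (\<phi> S) D" "\<phi> S t = \<phi> S s" by blast
        note ks = phi_ridge_kid[OF S(1) ps(1,2)]
        let ?I = "par d s \<inter> par d t" and ?u = "\<phi> S s"
        have fin: "finite (par d s)" "finite (par d t)" "finite (par d p)"
          using ridge_finite ps(1) t(2) pb(4) by auto
        have "card (par d s \<union> par d t) \<le> card (insert p (par d p))"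
          using pb fin by (intro card_mono) auto
        also have "\<dots> \<le> Suc d" using ridge_card[OF pb(4)] card_insert_le_m1[of "Suc d" "par d p" p] by simp
        finally have "d \<le> Suc (card ?I)"
          using card_Un_Int[OF fin(1,2)] ridge_card[OF ps(1)] ridge_card[OF t(2)] by simp
        also have "\<dots> = card (insert ?u (\<phi> S ` ?I))"
        proof -
          have "?u \<notin> \<phi> S ` ?I" using ks(1) by blast
          moreover have "card (\<phi> S ` ?I) = card ?I"
            by (intro card_image inj_on_subset[OF S(2)]) (use ps(3) in blast)
          ultimately show ?thesis using fin by simp
        qed
        also have "\<dots> \<le> card (insert ?u (\<phi> S ` par d s) \<inter> insert ?u (\<phi> S ` par d t))"
          using fin by (intro card_mono) auto
        finally have "insert ?u (\<phi> S ` par d s) = insert ?u (\<phi> S ` par d t)"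
          using steiner_unique[OF steiner_tuplesD[OF S(1) ps(6)] ks(2), of "insert ?u (\<phi> S ` par d t)"]
            kt(2)[OF S(1)] 4(2) S(3) by simp
        then have "\<phi> S ` par d s = \<phi> S ` par d t" using ks(1) kt(1)[OF S(1)] S(3) by (metis insert_ident)
        then show False using ne S(2) ps(3) t(4) by (metis inj_on_image_eq_iff)
      qed
      then show ?thesis by (rule empty)
    next
      case 2
      \<comment> \<open>A base parent of \<open>s\<close> would make \<open>q\<close> equal to
        \<open>Base (d - 1)\<close>, and the rank condition would make \<open>p\<close> the same
        vertex.\<close>
      have b: "par d s \<noteq> base_ridge d"
      proof
        assume "par d s = base_ridge d"
        then have "q = Base (d - 1)" using nq(4) by auto
        moreover have "p = Base (d - 1)"
        proof (rule ccontr)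
          assume "p \<noteq> Base (d - 1)"
          then have "d \<le> rk p" using np(4) ancestralD(4)[OF D(2) pD] by blast
          then show False using 2(2) \<open>q = Base (d - 1)\<close> d_pos by simp
        qed
        ultimately show False using 2(1) by simp
      qed
      show ?thesis
      proof (rule bound[OF qD])
        show "q \<notin> base_ridge d" using nq(4) b by blast
        fix S S' assume *: "S \<in> ?E" "S' \<in> ?E" "\<And>c. c \<noteq> col q \<Longrightarrow> S c = S' c"
          "\<And>v. v \<in> older D q \<Longrightarrow> \<phi> S v = \<phi> S' v"
        show "\<phi> S q = \<phi> S' q"
          using *(1,2) 4(2)
          by (intro later[OF t(2,3,4) p ps(1-3) q _ 2 b _ _ _ _ *(3,4)]) auto
      qed
    next
      case 3
      have b: "par d t \<noteq> base_ridge d"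
      proof
        assume "par d t = base_ridge d"
        then have "rk p = d - 1" using np(4) by auto
        then show False using nq(3) 3(2) by simp
      qed
      show ?thesis
      proof (rule bound[OF pD])
        show "p \<notin> base_ridge d" using np(4) b by blast
        fix S S' assume *: "S \<in> ?E" "S' \<in> ?E" "\<And>c. c \<noteq> col p \<Longrightarrow> S c = S' c"
          "\<And>v. v \<in> older D p \<Longrightarrow> \<phi> S v = \<phi> S' v"
        show "\<phi> S p = \<phi> S' p"
          using *(1,2) 3 4(2)
          by (intro later[OF ps(1-3) q t(2,3,4) p _ _ _ b _ _ _ _ *(3,4)]) auto
      qed
    qed
  qed
qed

text \<open>Vertices are removed by decreasing rank, so the parent of the removed \<open>t\<close>
  stays. If injectivity is lost only with \<open>t\<close>, then \<open>t\<close> collides with one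
  of the \<open>m = card D - 1\<close> remaining vertices, and
  \<open>m\<^sup>2 + m \<le> (m + 1)\<^sup>2\<close> closes the induction.\<close>

lemma non_injective_bound:
  assumes "finite D" "ancestral d k D"
  shows "card {S \<in> tuples. \<not> inj_on (\<phi> S) D} * (n - card D) \<le> (card D)\<^sup>2 * card tuples"
  using assms
proof (induction "card D" arbitrary: D rule: less_induct)
  case less
  note D = less.prems
  show ?case
  proof (cases "D = base_ridge d")
    case True
    have "inj_on (\<phi> S) D" for S using e_inj unfolding True by (auto simp: base_ridge_def inj_on_def)
    then show ?thesis by simp
  next
    case False
    then have ne: "D - base_ridge d \<noteq> {}" using D(2) by (auto simp: ancestral_def)
    have fin: "finite (rk ` (D - base_ridge d))" using D(1) by simp
    then have "Max (rk ` (D - base_ridge d)) \<in> rk ` (D - base_ridge d)" using ne by simp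
    then obtain t where t: "t \<in> D" "t \<notin> base_ridge d" "\<And>x. x \<in> D - base_ridge d \<Longrightarrow> rk x \<le> rk t"
      using Max_ge[OF fin] by auto
    note pt = ancestralD[OF D(2) t(1,2)]
    let ?D = "D - {t}"
    have D0: "finite ?D" "ancestral d k ?D" using D ancestral_remove[OF D(2) t] by auto
    have cD: "card D = Suc (card ?D)" using D(1) t(1) by (metis card.remove)
    let ?B = "{S \<in> tuples. \<not> inj_on (\<phi> S) D}" and ?N = "{S \<in> tuples. \<not> inj_on (\<phi> S) ?D}"
    let ?E = "\<lambda>s. {S \<in> tuples. inj_on (\<phi> S) ?D \<and> \<phi> S t = \<phi> S s}"
    let ?m = "n - card ?D"
    have "?B \<subseteq> ?N \<union> (\<Union>s\<in>?D. ?E s)"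
    proof
      fix S assume S: "S \<in> ?B"
      show "S \<in> ?N \<union> (\<Union>s\<in>?D. ?E s)"
      proof (cases "inj_on (\<phi> S) ?D")
        case True
        then have "\<phi> S t \<in> \<phi> S ` ?D"
          using S inj_on_insert[of "\<phi> S" t ?D] t(1) by (simp add: insert_absorb)
        then show ?thesis using S True by auto
      qed (use S in auto)
    qed
    then have "card ?B \<le> card (?N \<union> (\<Union>s\<in>?D. ?E s))"
      using finite_steiner_tuples D(1) by (intro card_mono) auto
    also have "\<dots> \<le> card ?N + card (\<Union>s\<in>?D. ?E s)" by (rule card_Un_le)
    also have "card (\<Union>s\<in>?D. ?E s) \<le> (\<Sum>s\<in>?D. card (?E s))" using D0(1) by (rule card_UN_le)
    finally have "card ?B \<le> card ?N + (\<Sum>s\<in>?D. card (?E s))" by simp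
    then have "card ?B * (n - card D) \<le> card ?B * ?m" "card ?B * ?m \<le> (card ?N + (\<Sum>s\<in>?D. card (?E s))) * ?m"
      using cD by (auto intro: mult_le_mono)
    then have "card ?B * (n - card D) \<le> (card ?N + (\<Sum>s\<in>?D. card (?E s))) * ?m"
      by (rule order_trans)
    moreover have "(card ?N + (\<Sum>s\<in>?D. card (?E s))) * ?m = card ?N * ?m + (\<Sum>s\<in>?D. card (?E s) * ?m)"
      by (simp add: distrib_right sum_distrib_right)
    moreover have "card ?N * ?m + (\<Sum>s\<in>?D. card (?E s) * ?m)
      \<le> (card ?D)\<^sup>2 * card tuples + (\<Sum>s\<in>?D. card tuples)"
    proof (intro add_mono sum_mono)
      show "card ?N * ?m \<le> (card ?D)\<^sup>2 * card tuples"
        using less.hyps[OF _ D0] cD by simp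
      have "par d t \<subseteq> ?D" using pt(3) kids_notin[OF pt(1,2)] by blast
      then show "card (?E s) * ?m \<le> card tuples" if "s \<in> ?D" for s
        using collision_bound[OF D0 that _ pt(1,2)] by simp
    qed
    moreover have "(card ?D)\<^sup>2 * card tuples + (\<Sum>s\<in>?D. card tuples)
      = ((card ?D)\<^sup>2 + card ?D) * card tuples" by (simp add: distrib_right)
    moreover have "((card ?D)\<^sup>2 + card ?D) * card tuples \<le> (card D)\<^sup>2 * card tuples"
      unfolding cD by (intro mult_le_mono) (simp_all add: power2_eq_square)
    ultimately show ?thesis by linarith
  qed
qed

end

section \<open>Random Steiner complexes\<close>

text \<open>By independence every point of the product has probability
  \<open>(1 / card A) ^ k\<close>, and the event is a finite disjoint union of such atoms.
  \<open>restrict\<close> turns the random tuple into an element of the extensional product.\<close>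

lemma (in prob_space) uniform_tuple_prob:
  fixes S :: "nat \<Rightarrow> 'a \<Rightarrow> 'b"
  assumes A: "finite A" and k: "k \<ge> 1"
    and indep: "indep_vars (\<lambda>_. count_space A) S {1..k}"
    and unif: "\<forall>j\<in>{1..k}. distr M (count_space A) (S j) = uniform_count_measure A"
    and Q: "Q \<subseteq> PiE {1..k} (\<lambda>_. A)"
  shows "prob {\<omega> \<in> space M. restrict (\<lambda>j. S j \<omega>) {1..k} \<in> Q}
    = card Q / card (PiE {1..k} (\<lambda>_. A))"
proof -
  let ?I = "{1..k}"
  let ?ev = "\<lambda>a. \<Inter>j\<in>?I. S j -` {a j} \<inter> space M"
  have meas: "S j \<in> measurable M (count_space A)" if "j \<in> ?I" for j
    using indep that by (simp add: indep_vars_def)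
  have finQ: "finite Q" using Q finite_PiE[of ?I "\<lambda>_. A"] A by (auto intro: finite_subset)
  have aA: "a j \<in> A" if "a \<in> Q" "j \<in> ?I" for a j using that Q by blast
  have one: "prob (S j -` {a j} \<inter> space M) = 1 / card A" if "a \<in> Q" "j \<in> ?I" for a j
  proof -
    have "prob (S j -` {a j} \<inter> space M) = measure (distr M (count_space A) (S j)) {a j}"
      using aA[OF that] meas[OF that(2)] by (simp add: measure_distr)
    also have "\<dots> = 1 / card A"
      using unif that(2) aA[OF that] A by (simp add: measure_uniform_count_measure)
    finally show ?thesis .
  qed
  have evs: "?ev a \<in> events" if "a \<in> Q" for a
  proof (rule sets.finite_INT)
    show "S j -` {a j} \<inter> space M \<in> events" if "j \<in> ?I" for j
      using measurable_sets[OF meas[OF that], of "{a j}"] aA[OF \<open>a \<in> Q\<close> that] by simp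
  qed (use k in auto)
  have prob_ev: "prob (?ev a) = (1 / card A) ^ k" if "a \<in> Q" for a
  proof -
    have "prob (?ev a) = (\<Prod>j\<in>?I. prob (S j -` {a j} \<inter> space M))"
      using k aA[OF that] by (intro indep_varsD_finite[OF indep]) auto
    then show ?thesis using one[OF that] by simp
  qed
  have eq: "{\<omega> \<in> space M. restrict (\<lambda>j. S j \<omega>) ?I \<in> Q} = (\<Union>a\<in>Q. ?ev a)"
  proof (intro set_eqI iffI)
    fix \<omega> assume "\<omega> \<in> {\<omega> \<in> space M. restrict (\<lambda>j. S j \<omega>) ?I \<in> Q}"
    then show "\<omega> \<in> (\<Union>a\<in>Q. ?ev a)"
      by (intro UN_I[of "restrict (\<lambda>j. S j \<omega>) ?I"]) auto
  next
    fix \<omega> assume "\<omega> \<in> (\<Union>a\<in>Q. ?ev a)"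
    then obtain a where a: "a \<in> Q" "\<omega> \<in> ?ev a" by blast
    then have "\<omega> \<in> space M" using k by auto
    moreover have "restrict (\<lambda>j. S j \<omega>) ?I = restrict a ?I" using a(2) by (intro restrict_ext) auto
    moreover have "restrict a ?I = a" using Q a(1) by (intro PiE_restrict) blast
    ultimately show "\<omega> \<in> {\<omega> \<in> space M. restrict (\<lambda>j. S j \<omega>) ?I \<in> Q}" using a(1) by simp
  qed
  have "disjoint_family_on ?ev Q"
    unfolding disjoint_family_on_def
  proof (intro ballI impI)
    fix a b assume ab: "a \<in> Q" "b \<in> Q" "a \<noteq> b"
    then obtain j where "j \<in> ?I" "a j \<noteq> b j" using PiE_ext[of a ?I "\<lambda>_. A" b] Q by blast
    then show "?ev a \<inter> ?ev b = {}" by auto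
  qed
  then have "prob (\<Union>a\<in>Q. ?ev a) = (\<Sum>a\<in>Q. prob (?ev a))"
    using evs finQ by (intro finite_measure_finite_Union) auto
  then show ?thesis
    unfolding eq using prob_ev by (simp add: card_PiE power_divide)
qed

lemma (in steiner_cover) tree_nbhd_iso:
  assumes "S \<in> tuples" "inj_on (\<phi> S) D"
    and "\<Union>{A \<in> faces (arboreal d k) (int d). \<exists>\<rho>\<in>line_ball d (arboreal d k) (base_ridge d) r. \<rho> \<subseteq> A} \<subseteq> D"
  shows "simplicial_iso (nbhd_complex d (arboreal d k) (base_ridge d) r)
    (nbhd_complex d (steiner_complex d k n S) (e ` {..<d}) r)"
  using cover.nbhd_iso[OF cover_steiner[OF assms(1)], of "base_ridge d" r]
    inj_on_subset[OF assms(2,3)] ridges.base_ridge faces_arboreal cover_map_base_ridge by metis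

lemma (in coloured_complex) finite_star:
  assumes "\<rho> \<in> faces X (int d - 1)"
  shows "finite {A \<in> faces X (int d). \<rho> \<subseteq> A}"
proof (rule finite_subset)
  show "{A \<in> faces X (int d). \<rho> \<subseteq> A} \<subseteq> (\<lambda>c. THE A. A \<in> C c \<and> \<rho> \<subseteq> A) ` {1..k}"
  proof
    fix A assume A: "A \<in> {A \<in> faces X (int d). \<rho> \<subseteq> A}"
    then obtain c where c: "c \<in> {1..k}" "A \<in> C c" using top_faces by blast
    then have "(THE A. A \<in> C c \<and> \<rho> \<subseteq> A) = A"
      using ex1_face[OF c(1) assms] A by (intro the1_equality) auto
    then show "A \<in> (\<lambda>c. THE A. A \<in> C c \<and> \<rho> \<subseteq> A) ` {1..k}" using c(1) by blast
  qed
qed simp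

text \<open>The error depends on \<open>n\<close> and \<open>card D\<close> only, so a single
  \<open>D\<close> can serve a whole sequence of complexes.\<close>

lemma (in arboreal_params) nbhd_iso_probability:
  assumes X: "random_steiner_complex d k n M X" and \<sigma>: "\<sigma> \<subseteq> {1..n}" "card \<sigma> = d"
    and \<tau>: "\<tau> \<in> ridges d k" and D: "finite D" "ancestral d k D" "card D < n"
    and ball: "\<Union>{A \<in> faces (arboreal d k) (int d).
      \<exists>\<rho>\<in>line_ball d (arboreal d k) (base_ridge d) r. \<rho> \<subseteq> A} \<subseteq> D"
  shows "1 - (card D)\<^sup>2 / (real n - card D) \<le> measure M {\<omega> \<in> space M.
    simplicial_iso (nbhd_complex d (X \<omega>) \<sigma> r) (nbhd_complex d (arboreal d k) \<tau> r)}"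
    and "measure M {\<omega> \<in> space M.
      simplicial_iso (nbhd_complex d (X \<omega>) \<sigma> r) (nbhd_complex d (arboreal d k) \<tau> r)} \<le> 1"
proof -
  interpret prob_space M using X by (simp add: random_steiner_complex_def)
  let ?\<Omega> = "steiner_systems n d"
  obtain S where indep: "indep_vars (\<lambda>_. count_space ?\<Omega>) S {1..k}"
    and unif: "\<forall>j\<in>{1..k}. distr M (count_space ?\<Omega>) (S j) = uniform_count_measure ?\<Omega>"
    and XS: "\<forall>\<omega>\<in>space M. X \<omega> = {A. A \<subseteq> {1..n} \<and> card A \<le> d} \<union> (\<Union>j\<in>{1..k}. S j \<omega>)"
    using X unfolding random_steiner_complex_def by blast
  have "finite \<sigma>" using \<sigma>(1) finite_subset by blast
  then obtain e where e: "bij_betw e {..<d} \<sigma>"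
    using ex_bij_betw_nat_finite[of \<sigma>] \<sigma>(2) by (auto simp: lessThan_atLeast0)
  interpret steiner_cover d k n e
    using e \<sigma> d_pos k_pos by unfold_locales (auto simp: bij_betw_def)
  let ?iso = "\<lambda>Y. simplicial_iso (nbhd_complex d Y \<sigma> r) (nbhd_complex d (arboreal d k) \<tau> r)"
  let ?f = "\<lambda>\<omega>. restrict (\<lambda>j. S j \<omega>) {1..k}"
  have f: "?f \<omega> \<in> tuples" "X \<omega> = steiner_complex d k n (?f \<omega>)" if "\<omega> \<in> space M" for \<omega>
  proof -
    have "S j \<omega> \<in> ?\<Omega>" if "j \<in> {1..k}" for j
      using indep that measurable_space[of "S j" M "count_space ?\<Omega>" \<omega>] \<open>\<omega> \<in> space M\<close>
      by (simp add: indep_vars_def)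
    then show "?f \<omega> \<in> tuples" by (simp add: steiner_tuples_def)
    show "X \<omega> = steiner_complex d k n (?f \<omega>)"
      using XS that by (simp add: steiner_complex_def)
  qed
  let ?G = "{S \<in> tuples. ?iso (steiner_complex d k n S)}"
  have eq: "{\<omega> \<in> space M. ?iso (X \<omega>)} = {\<omega> \<in> space M. ?f \<omega> \<in> ?G}"
    using f by (intro Collect_cong conj_cong refl) simp
  have "prob {\<omega> \<in> space M. ?f \<omega> \<in> ?G} = card ?G / card tuples"
    unfolding steiner_tuples_def[of d k n]
    by (rule uniform_tuple_prob[OF finite_steiner_systems k_pos indep unif]) auto
  then have P: "prob {\<omega> \<in> space M. ?iso (X \<omega>)} = card ?G / card tuples" by (simp only: eq)
  let ?N = "{S \<in> tuples. \<not> inj_on (\<phi> S) D}"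
  \<comment> \<open>The cover compares with the ball at the base ridge; homogeneity of the arboreal
    complex moves it to \<open>\<tau>\<close>.\<close>
  have good: "?iso (steiner_complex d k n S)" if "S \<in> tuples" "inj_on (\<phi> S) D" for S
  proof -
    have "e ` {..<d} = \<sigma>" using e by (simp add: bij_betw_def)
    then show ?thesis
      using simplicial_iso_sym[OF tree_nbhd_iso[OF that ball]] arboreal_homogeneous[OF \<tau>, of r]
        simplicial_iso_trans by metis
  qed
  \<comment> \<open>A probability space has a point, and the systems at that point form a tuple; so
    the divisions by \<open>card tuples\<close> are genuine.\<close>
  have "tuples \<noteq> {}" using f(1) not_empty by blast
  then have pos: "0 < card tuples" using finite_steiner_tuples by (simp add: card_gt_0_iff)
  have "tuples \<subseteq> ?G \<union> ?N" using good by blast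
  then have "card tuples \<le> card (?G \<union> ?N)" using finite_steiner_tuples by (intro card_mono) auto
  also have "\<dots> \<le> card ?G + card ?N" by (rule card_Un_le)
  finally have "real (card tuples) \<le> card ?G + card ?N" by linarith
  then have "1 \<le> (card ?G + card ?N) / card tuples" using pos by simp
  moreover have "card ?N / card tuples \<le> (card D)\<^sup>2 / (real n - card D)"
  proof -
    have "real (card ?N * (n - card D)) \<le> real ((card D)\<^sup>2 * card tuples)"
      using non_injective_bound[OF D(1,2)] by (rule of_nat_mono)
    then have "card ?N * (real n - card D) \<le> (card D)\<^sup>2 * card tuples"
      using D(3) by (simp add: of_nat_diff)
    then show ?thesis using D(3) pos by (simp add: field_simps)
  qed
  ultimately show "1 - (card D)\<^sup>2 / (real n - card D) \<le> prob {\<omega> \<in> space M. ?iso (X \<omega>)}"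
    unfolding P by (simp add: add_divide_distrib)
  show "prob {\<omega> \<in> space M. ?iso (X \<omega>)} \<le> 1" by (rule prob_le_1)
qed

theorem theorem2p3:
  fixes d k :: nat and n :: "nat \<Rightarrow> nat"
    and M :: "nat \<Rightarrow> 'w measure" and X :: "nat \<Rightarrow> 'w \<Rightarrow> nat set set"
    and \<sigma> :: "nat \<Rightarrow> nat set" and \<tau> :: "tree_vertex set" and r :: real
  assumes "d \<ge> 1" and "k \<ge> 1"
    and "\<And>i. admissible d (n i)"
    and "filterlim n at_top sequentially"
    and "\<And>i. random_steiner_complex d k (n i) (M i) (X i)"
    and "\<And>i. \<sigma> i \<subseteq> {1..n i} \<and> card (\<sigma> i) = d"
    and "\<tau> \<in> faces (arboreal d k) (int d - 1)"
    and "r > 0"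
  shows "(\<lambda>i. measure (M i) {\<omega> \<in> space (M i).
            simplicial_iso (nbhd_complex d (X i \<omega>) (\<sigma> i) r)
                           (nbhd_complex d (arboreal d k) \<tau> r)})
         \<longlonglongrightarrow> 1"
proof -
  interpret arboreal_params d k by unfold_locales (use assms(1,2) in auto)
  interpret T: coloured_complex d k "arboreal d k" "tree_faces d k" by (rule coloured_arboreal)
  have base: "base_ridge d \<in> faces (arboreal d k) (int d - 1)"
    using ridges.base_ridge faces_arboreal by simp
  have \<tau>: "\<tau> \<in> ridges d k" using assms(7) faces_arboreal by simp
  let ?B = "line_ball d (arboreal d k) (base_ridge d) r"
  let ?\<A> = "{A \<in> faces (arboreal d k) (int d). \<exists>\<rho>\<in>?B. \<rho> \<subseteq> A}"
  \<comment> \<open>The ball is finite and every ridge has finitely many faces above it. None of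
    this involves \<open>i\<close>, so \<open>D\<close> is fixed before the limit is taken.\<close>
  have "?\<A> = (\<Union>\<rho>\<in>?B. {A \<in> faces (arboreal d k) (int d). \<rho> \<subseteq> A})" by blast
  moreover have "finite \<dots>"
    using T.finite_line_ball[OF base] T.finite_star by (intro finite_UN_I) (auto simp: line_ball_iff)
  ultimately have "finite ?\<A>" by simp
  moreover have "?\<A> \<subseteq> arboreal d k" by (auto simp: faces_def)
  ultimately obtain D where D: "finite D" "ancestral d k D" "\<Union>?\<A> \<subseteq> D"
    by (rule faces_ancestral)
  have ev: "eventually (\<lambda>i. card D < n i) sequentially"
    using assms(4)[unfolded filterlim_at_top, rule_format, of "Suc (card D)"]
    by (simp add: Suc_le_eq)
  have "filterlim (\<lambda>i. real (n i)) at_top sequentially"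
    using filterlim_compose[OF filterlim_real_sequentially assms(4)] .
  then have "filterlim (\<lambda>i. - real (card D) + real (n i)) at_top sequentially"
    by (rule filterlim_tendsto_add_at_top[OF tendsto_const])
  then have "(\<lambda>i. (card D)\<^sup>2 / (- real (card D) + real (n i))) \<longlonglongrightarrow> 0"
    by (intro tendsto_divide_0[OF tendsto_const] filterlim_at_top_imp_at_infinity)
  then have lower: "(\<lambda>i. 1 - (card D)\<^sup>2 / (real (n i) - card D)) \<longlonglongrightarrow> 1"
    using tendsto_diff[OF tendsto_const, of _ 0 sequentially "1::real"] by simp
  show ?thesis
  proof (rule tendsto_sandwich[OF _ _ lower tendsto_const])
    note * = nbhd_iso_probability[OF assms(5) _ _ \<tau> D(1,2) _ D(3)]
    show "\<forall>\<^sub>F i in sequentially. 1 - (card D)\<^sup>2 / (real (n i) - card D)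
      \<le> measure (M i) {\<omega> \<in> space (M i). simplicial_iso (nbhd_complex d (X i \<omega>) (\<sigma> i) r)
            (nbhd_complex d (arboreal d k) \<tau> r)}"
      using ev by eventually_elim (use *(1) assms(6) in blast)
    show "\<forall>\<^sub>F i in sequentially. measure (M i) {\<omega> \<in> space (M i).
        simplicial_iso (nbhd_complex d (X i \<omega>) (\<sigma> i) r) (nbhd_complex d (arboreal d k) \<tau> r)} \<le> 1"
      using ev by eventually_elim (use *(2) assms(6) in blast)
  qed
qed

end
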